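(* Let $t\ge3$ and $s\ge1$ be integers, and let $R$ be a $\mathcal K_t$-free weighted graph. Fix $\varepsilon>0$ and an integer $h\ge16$. Then for all sufficiently large $N$ there is a $K_t$-free graph $G$ on $N$ vertices with independence number $\alpha(G)\le 3e^{-\varepsilon\sqrt h/4}N$ and $d_{K_s}(G)\ge(1-2\sqrt2 s^2\varepsilon)\,d_{K_s}(R)$.
   Context: For an $N$-vertex graph $G$, $d_{K_s}(G)$ is the number of ordered $s$-tuples of vertices forming a copy of $K_s$, divided by $N^s$. A weighted graph $R=(V,w)$ is a finite set $V$ with $w:V\sqcup V^2\to[0,1]$ such that $\sum_{v}w(v)=1$, $w(v,v')=w(v',v)$, $w(v,v)=0$. $R_{>\alpha}$ is the spanning graph of pairs of weight $>\alpha$. $d_{K_s}(R)=\sum_{\sigma:[s]\to V}\prod_{i}w(\sigma(i))\prod_{1\le i<j\le s}w(\sigma(i),\sigma(j))$. $R$ is $\mathcal K_t$-free if there are no $S_2\subseteq S_1\subseteq V$ with $|S_1|,|S_2|\ge1$, $|S_1|+|S_2|=t$, $S_1$ a clique in $R_{>0}$ and $S_2$ a clique in $R_{>1/2}$. *)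

theory Defs
  imports Complex_Main "HOL-Library.FuncSet"
begin

record 'a graph =
  verts :: "'a set"
  edges :: "'a set set"

locale finite_simple_graph =
  fixes G :: "'a graph"
  assumes finite_verts: "finite (verts G)"
    and edges_two_sets: "edges G \<subseteq> {e. e \<subseteq> verts G \<and> card e = 2}"

definition clique :: "'a graph \<Rightarrow> 'a set \<Rightarrow> bool" where
  "clique G S \<longleftrightarrow> S \<subseteq> verts G \<and> (\<forall>u\<in>S. \<forall>v\<in>S. u \<noteq> v \<longrightarrow> {u, v} \<in> edges G)"

definition independent :: "'a graph \<Rightarrow> 'a set \<Rightarrow> bool" where
  "independent G S \<longleftrightarrow> S \<subseteq> verts G \<and> (\<forall>u\<in>S. \<forall>v\<in>S. {u, v} \<notin> edges G)"

definition independence_number :: "'a graph \<Rightarrow> nat" where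
  "independence_number G = Max {card S |S. independent G S}"

definition clique_free :: "nat \<Rightarrow> 'a graph \<Rightarrow> bool" where
  "clique_free t G \<longleftrightarrow> \<not> (\<exists>S. clique G S \<and> card S = t)"

text \<open>Ordered \<open>s\<close>-tuples of vertices are extensional maps from \<open>{1..s}\<close> to the vertex set.\<close>

definition clique_density :: "nat \<Rightarrow> 'a graph \<Rightarrow> real" where
  "clique_density s G =
     real (card {\<sigma> \<in> {1..s} \<rightarrow>\<^sub>E verts G. inj_on \<sigma> {1..s} \<and> clique G (\<sigma> ` {1..s})})
       / real (card (verts G)) ^ s"

text \<open>The weight function on the disjoint union of \<open>V\<close> and \<open>V\<^sup>2\<close> is given by its two restrictions
  \<open>vweight\<close> and \<open>eweight\<close>. Their values outside \<open>V\<close> are unconstrained and never used.\<close>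

record 'a wgraph =
  wverts :: "'a set"
  vweight :: "'a \<Rightarrow> real"
  eweight :: "'a \<Rightarrow> 'a \<Rightarrow> real"

locale weighted_graph =
  fixes R :: "'a wgraph"
  assumes finite_wverts: "finite (wverts R)"
    and vweight_range: "v \<in> wverts R \<Longrightarrow> vweight R v \<in> {0..1}"
    and eweight_range: "u \<in> wverts R \<Longrightarrow> v \<in> wverts R \<Longrightarrow> eweight R u v \<in> {0..1}"
    and vweight_sum: "(\<Sum>v\<in>wverts R. vweight R v) = 1"
    and eweight_sym: "u \<in> wverts R \<Longrightarrow> v \<in> wverts R \<Longrightarrow> eweight R u v = eweight R v u"
    and eweight_diag: "v \<in> wverts R \<Longrightarrow> eweight R v v = 0"

definition threshold_graph :: "'a wgraph \<Rightarrow> real \<Rightarrow> 'a graph" where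
  "threshold_graph R \<alpha> =
     \<lparr>verts = wverts R,
      edges = {{u, v} |u v. u \<in> wverts R \<and> v \<in> wverts R \<and> u \<noteq> v \<and> eweight R u v > \<alpha>}\<rparr>"

definition weighted_clique_density :: "nat \<Rightarrow> 'a wgraph \<Rightarrow> real" where
  "weighted_clique_density s R =
     (\<Sum>\<sigma>\<in>{1..s} \<rightarrow>\<^sub>E wverts R.
        (\<Prod>i\<in>{1..s}. vweight R (\<sigma> i)) *
        (\<Prod>(i, j)\<in>{(i, j). 1 \<le> i \<and> i < j \<and> j \<le> s}. eweight R (\<sigma> i) (\<sigma> j)))"

definition weighted_clique_free :: "nat \<Rightarrow> 'a wgraph \<Rightarrow> bool" where
  "weighted_clique_free t R \<longleftrightarrow>
     \<not> (\<exists>S1 S2. S2 \<subseteq> S1 \<and> S1 \<subseteq> wverts R \<and> card S1 \<ge> 1 \<and> card S2 \<ge> 1 \<and> card S1 + card S2 = t \<and>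
          clique (threshold_graph R 0) S1 \<and> clique (threshold_graph R (1/2)) S2)"

end

theory Submission
  imports Defs "HOL-Real_Asymp.Real_Asymp"
begin

text \<open>
  Since only the bound \<open>\<alpha>(G) \<le> \<theta> N\<close> for an arbitrary constant \<open>\<theta> > 0\<close> matters, a
  random variant of the Bollobas--Erdos graph on a discrete cube suffices. In \<open>{-1, 1}\<^sup>n\<close> join two
  points when they agree in fewer than \<open>k\<close> coordinates, \<open>k\<close> a large multiple of \<open>\<surd>n\<close>: there is no
  triangle, and by isoperimetry independent sets have small density. Across two classes of weight
  at most 1/2, join \<open>x\<close> and \<open>y\<close> when \<open>x\<^sup>T M y \<ge> L\<close>, where \<open>M\<close> is a random sign matrix and
  \<open>L = o(n)\<close>; each pair is joined with probability \<open>1/2 - o(1)\<close>. If \<open>x, x'\<close> and \<open>y, y'\<close> are joined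
  inside their classes, then \<open>x + x'\<close> and \<open>y + y'\<close> are sparse, and a union bound shows that
  \<open>(x + x')\<^sup>T M (y + y') < 4 L\<close> for all such pairs simultaneously, which excludes \<open>K\<^sub>4\<close>.
  Blowing up \<open>R\<close> with independent matrices for the different pairs of classes, the joining
  probabilities multiply exactly, so some choice attains the expected clique density.
\<close>

subsection \<open>Isoperimetry in the cube\<close>

definition cube :: "'i set \<Rightarrow> ('i \<Rightarrow> real) set" where
  "cube I = I \<rightarrow>\<^sub>E {-1, 1}"

lemma finite_cube: "finite I \<Longrightarrow> finite (cube I)"
  by (simp add: cube_def finite_PiE)

lemma card_cube: "finite I \<Longrightarrow> card (cube I) = 2 ^ card I"
  by (simp add: cube_def card_PiE numeral_2_eq_2)

lemma cubeD: "x \<in> cube I \<Longrightarrow> i \<in> I \<Longrightarrow> x i = -1 \<or> x i = 1"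
  by (auto simp: cube_def PiE_def Pi_def)

lemma restrict_in_cube: "(\<And>i. i \<in> I \<Longrightarrow> f i = -1 \<or> f i = 1) \<Longrightarrow> restrict f I \<in> cube I"
  by (auto simp: cube_def)

lemma cube_eqI:
  assumes "x \<in> cube I" "y \<in> cube I" "\<And>i. i \<in> I \<Longrightarrow> x i = y i"
  shows "x = y"
  using assms PiE_ext unfolding cube_def by blast

text \<open>Inverting the quadratic lower bound on \<open>exp y\<close> gives
  \<open>exp (- y) \<le> 1 - y + y\<^sup>2\<close>; added to the upper bound on
  \<open>exp y\<close>, the linear terms cancel. This cosh bound serves both the isoperimetry and
  the tail estimate.\<close>

lemma exp_plus_exp_minus_le:
  fixes y :: real
  assumes "0 \<le> y" "y \<le> 1"
  shows "exp y + exp (- y) \<le> 2 * exp (y\<^sup>2)"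
proof -
  have 1: "exp y \<le> 1 + y + y\<^sup>2" using exp_bound assms by blast
  have 2: "1 + y + y\<^sup>2/2 \<le> exp y" using exp_lower_Taylor_quadratic assms by blast
  have "1 \<le> (1 + y + y\<^sup>2/2) * (1 - y + y\<^sup>2)"
  proof -
    have "(1 + y + y\<^sup>2/2) * (1 - y + y\<^sup>2) = 1 + y\<^sup>2/2 + y^3/2 + y^4/2"
      by (simp add: field_simps power2_eq_square power3_eq_cube power4_eq_xxxx)
    then show ?thesis using assms by simp
  qed
  also have "\<dots> \<le> exp y * (1 - y + y\<^sup>2)"
    using 2 assms by (intro mult_right_mono) auto
  finally have "exp (- y) \<le> 1 - y + y\<^sup>2"
    by (simp add: exp_minus field_simps)
  moreover have "1 + y\<^sup>2 \<le> exp (y\<^sup>2)" by (rule exp_ge_add_one_self)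
  ultimately show ?thesis using 1 by linarith
qed

text \<open>Cutting along coordinate \<open>i\<close> leaves two subsets of the smaller cube, which
  is what an induction on the dimension needs.\<close>

lemma card_insert_slices:
  assumes "finite I" "i \<notin> I" "A \<subseteq> cube (insert i I)"
  shows "card A = card {x \<in> cube I. x(i := 1) \<in> A} + card {x \<in> cube I. x(i := - 1) \<in> A}"
proof -
  let ?S = "\<lambda>s. {x \<in> cube I. x(i := s) \<in> A}" and ?u = "\<lambda>s x. x(i := s :: real)"
  have inj: "inj_on (?u s) (?S s)" for s
  proof (rule inj_onI)
    fix x y assume xy: "x \<in> ?S s" "y \<in> ?S s" "x(i := s) = y(i := s)"
    then have "x i = y i" using assms(2) by (auto simp: cube_def PiE_def extensional_def)
    then show "x = y" using xy(3) by (metis fun_upd_triv fun_upd_upd)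
  qed
  have "A = ?u 1 ` ?S 1 \<union> ?u (-1) ` ?S (-1)"
  proof (intro equalityI subsetI)
    fix a assume a: "a \<in> A"
    then have "a \<in> (\<lambda>(y, g). g(i := y)) ` ({-1,1} \<times> cube I)"
      using assms(3) unfolding cube_def by (auto simp: PiE_insert_eq)
    then show "a \<in> ?u 1 ` ?S 1 \<union> ?u (-1) ` ?S (-1)" using a by auto
  qed auto
  then have "card A = card (?u 1 ` ?S 1 \<union> ?u (-1) ` ?S (-1))" by simp
  also have "\<dots> = card (?u 1 ` ?S 1) + card (?u (-1) ` ?S (-1))"
  proof (rule card_Un_disjoint)
    have "f i = s" if "f \<in> ?u s ` ?S s" for f s using that by auto
    then show "?u 1 ` ?S 1 \<inter> ?u (-1) ` ?S (-1) = {}" by fastforce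
  qed (use finite_cube[OF assms(1)] in auto)
  also have "\<dots> = card (?S 1) + card (?S (-1))" by (simp add: card_image[OF inj])
  finally show ?thesis .
qed

text \<open>For \<open>p\<close> between \<open>M / e\<close> and \<open>M * e\<close>, the sum is
  at most \<open>p + M\<^sup>2 / p\<close>, which is convex in \<open>p\<close> and takes the value
  \<open>M * (e + 1/e)\<close> at both ends. For smaller \<open>p\<close> the bound on
  \<open>q\<close> is enough.\<close>

lemma add_le_of_mult_le_square:
  fixes p q M e :: real
  assumes "0 \<le> p" "0 \<le> q" "0 < M" "1 \<le> e" "p \<le> M * e" "q \<le> M * e" "p * q \<le> M\<^sup>2"
  shows "p + q \<le> M * (e + 1/e)"
proof (cases "p \<le> M / e")
  case True
  then have "p + q \<le> M / e + M * e" using assms by linarith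
  then show ?thesis by (simp add: algebra_simps)
next
  case False
  then have p: "p > M / e" "p > 0" using assms by (auto simp: not_le intro: less_le_trans[rotated])
      (smt (verit, ccfv_SIG) divide_pos_pos)
  have "(p - M * e) * (p - M / e) \<le> 0" using p assms by (simp add: mult_nonpos_nonneg)
  then have "p\<^sup>2 + M\<^sup>2 \<le> M * (e + 1/e) * p"
    using assms(4) by (simp add: algebra_simps power2_eq_square)
  then have "p * (p + q) \<le> p * (M * (e + 1/e))" using assms(7)
    by (simp add: algebra_simps power2_eq_square)
  then show ?thesis using p(2) by simp
qed

text \<open>Induction on the dimension: slices with equal sign in the new coordinate keep distance
  \<open>k\<close>, slices with opposite signs keep \<open>k - 1\<close> and cost a factor
  \<open>exp t\<close>. The bound \<open>k\<close> is real and generalised because it may drop below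
  0; \<open>t\<close> is optimised later.\<close>

lemma cube_isoperimetry:
  assumes "finite I" and "0 \<le> t"
    and "A \<subseteq> cube I" "B \<subseteq> cube I"
    and "\<And>x y. x \<in> A \<Longrightarrow> y \<in> B \<Longrightarrow> k \<le> real (card {i \<in> I. x i \<noteq> y i})"
  shows "real (card A) * real (card B) \<le> exp (- t * k) * (2 + exp t + exp (- t)) ^ card I"
  using assms(1,3-)
proof (induction I arbitrary: A B k rule: finite_induct)
  case empty
  show ?case
  proof (cases "A = {} \<or> B = {}")
    case False
    then have AB: "A = {\<lambda>_. undefined}" "B = {\<lambda>_. undefined}"
      using empty.prems(1,2) by (auto simp: cube_def)
    then have "k \<le> 0" using empty.prems(3) by auto
    then have "t * k \<le> 0" using assms(2) by (simp add: mult_nonneg_nonpos)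
    then show ?thesis using AB by simp
  qed auto
next
  case (insert i I)
  let ?S = "\<lambda>A s. {x \<in> cube I. x(i := s) \<in> A}"
  define M where "M = exp (- t * k) * (2 + exp t + exp (- t)) ^ card I"
  have M: "M > 0" unfolding M_def by (intro mult_pos_pos zero_less_power) (auto simp: add_pos_pos)
  have upd: "card {j \<in> insert i I. (x(i := s)) j \<noteq> (y(i := r)) j}
      = card {j \<in> I. x j \<noteq> y j} + (if s = r then 0 else 1)" for x y :: "'a \<Rightarrow> real" and s r
  proof (cases "s = r")
    case True
    have "{j \<in> insert i I. (x(i := s)) j \<noteq> (y(i := r)) j} = {j \<in> I. x j \<noteq> y j}"
      using True insert.hyps by auto
    then show ?thesis using True by simp
  next
    case False
    have "{j \<in> insert i I. (x(i := s)) j \<noteq> (y(i := r)) j} = insert i {j \<in> I. x j \<noteq> y j}"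
      using False insert.hyps by auto
    then show ?thesis using False insert.hyps by simp
  qed
  have same: "real (card (?S A s)) * real (card (?S B s)) \<le> M" for s
    unfolding M_def
  proof (rule insert.IH)
    fix x y assume "x \<in> ?S A s" "y \<in> ?S B s"
    then have "x(i := s) \<in> A" "y(i := s) \<in> B" by blast+
    from insert.prems(3)[OF this] show "k \<le> real (card {i \<in> I. x i \<noteq> y i})" unfolding upd by simp
  qed auto
  have diff: "real (card (?S A s)) * real (card (?S B r)) \<le> M * exp t" if "s \<noteq> r" for s r
  proof -
    have "real (card (?S A s)) * real (card (?S B r))
        \<le> exp (- t * (k - 1)) * (2 + exp t + exp (- t)) ^ card I"
    proof (rule insert.IH)
      fix x y assume "x \<in> ?S A s" "y \<in> ?S B r"
      then have "x(i := s) \<in> A" "y(i := r) \<in> B" by blast+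
      from insert.prems(3)[OF this] show "k - 1 \<le> real (card {i \<in> I. x i \<noteq> y i})" unfolding upd using that by simp
    qed auto
    also have "exp (- t * (k - 1)) = exp (- t * k) * exp t"
      by (simp add: exp_add[symmetric] algebra_simps)
    finally have "real (card (?S A s)) * real (card (?S B r))
        \<le> exp (- t * k) * exp t * (2 + exp t + exp (- t)) ^ card I" .
    also have "\<dots> = M * exp t" unfolding M_def by algebra
    finally show ?thesis .
  qed
  define a1 where "a1 = real (card (?S A 1))"
  define a2 where "a2 = real (card (?S A (-1)))"
  define b1 where "b1 = real (card (?S B 1))"
  define b2 where "b2 = real (card (?S B (-1)))"
  note d = a1_def a2_def b1_def b2_def
  have h: "a1 * b1 \<le> M" "a2 * b2 \<le> M" "a1 * b2 \<le> M * exp t" "a2 * b1 \<le> M * exp t"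
    unfolding d using same diff by auto
  \<comment> \<open>The two mixed terms have the same product as \<open>a1 * b1\<close> and
    \<open>a2 * b2\<close>, at most \<open>M\<^sup>2\<close>, so they cannot both be near
    \<open>M * exp t\<close>. This saves the factor that makes the induction close.\<close>
  have "a1 * b2 + a2 * b1 \<le> M * (exp t + 1 / exp t)"
  proof (rule add_le_of_mult_le_square)
    have "(a1 * b1) * (a2 * b2) \<le> M * M" using h M by (intro mult_mono) (auto simp: d)
    then show "a1 * b2 * (a2 * b1) \<le> M\<^sup>2" by (simp add: power2_eq_square mult_ac)
  qed (use h M assms(2) in \<open>auto simp: d\<close>)
  then have "(a1 + a2) * (b1 + b2) \<le> M * (2 + exp t + exp (- t))"
    using h(1,2) by (simp add: algebra_simps exp_minus divide_inverse)
  moreover have "real (card A) = a1 + a2" "real (card B) = b1 + b2"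
    unfolding d card_insert_slices[OF insert.hyps insert.prems(1)] card_insert_slices[OF insert.hyps insert.prems(2)]
    by (simp_all only: of_nat_add)
  moreover have "M * (2 + exp t + exp (- t)) = exp (- t * k) * (2 + exp t + exp (- t)) ^ card (insert i I)"
    using insert.hyps by (simp add: M_def)
  ultimately show ?case by simp
qed

text \<open>On sign vectors this is the Hamming distance from \<open>x\<close> to
  \<open>- y\<close>, so a small value means nearly antipodal points.\<close>

definition agree :: "'i set \<Rightarrow> ('i \<Rightarrow> real) \<Rightarrow> ('i \<Rightarrow> real) \<Rightarrow> nat" where
  "agree I x y = card {i \<in> I. x i = y i}"

text \<open>Isoperimetry for \<open>A\<close> and its antipodal image: agreement of two points of
  \<open>A\<close> becomes distance between the two sets, and both have the same size.\<close>

lemma card_no_near_antipodal_le: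
  assumes "finite I" "A \<subseteq> cube I" "k \<le> 2 * card I"
    and far: "\<And>x y. x \<in> A \<Longrightarrow> y \<in> A \<Longrightarrow> k \<le> agree I x y"
  shows "real (card A) \<le> exp (- (real k)\<^sup>2 / (8 * real (card I))) * 2 ^ card I"
proof (cases "card I = 0")
  case True
  then have "A \<subseteq> {\<lambda>_. undefined}" using assms(1,2) by (auto simp: cube_def)
  then have "card A \<le> 1" using card_mono[of "{\<lambda>_. undefined}" A] by simp
  \<comment> \<open>Division by zero is 0, so the exponential factor is 1 and the right side is
    1.\<close>
  then show ?thesis using True by simp
next
  case False
  define n where "n = real (card I)"
  have n: "n > 0" using False by (simp add: n_def)
  \<comment> \<open>This value minimises \<open>n * t\<^sup>2 - t * k\<close>; the assumption
    \<open>k \<le> 2 * card I\<close> gives \<open>t \<le> 1\<close>, as the cosh bound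
    requires.\<close>
  define t where "t = real k / (2 * n)"
  have t: "0 \<le> t" "t \<le> 1" using assms(3) n by (auto simp: t_def n_def field_simps)
  define neg where "neg = (\<lambda>x. restrict (\<lambda>i. - x i :: real) I)"
  have inj: "inj_on neg A"
  proof (rule inj_onI)
    fix x y assume xy: "x \<in> A" "y \<in> A" "neg x = neg y"
    show "x = y"
    proof (rule cube_eqI)
      fix i assume "i \<in> I"
      then show "x i = y i" using fun_cong[OF xy(3), of i] by (simp add: neg_def)
    qed (use xy assms(2) in auto)
  qed
  have "real (card A) * real (card (neg ` A)) \<le> exp (- t * real k) * (2 + exp t + exp (- t)) ^ card I"
  proof (rule cube_isoperimetry[OF assms(1) t(1) assms(2)])
    show "neg ` A \<subseteq> cube I"
    proof
      fix y assume "y \<in> neg ` A"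
      then obtain x where x: "x \<in> A" "y = neg x" by auto
      have "neg x \<in> cube I" unfolding neg_def
      proof (rule restrict_in_cube)
        fix i assume "i \<in> I"
        then have "x i = -1 \<or> x i = 1" by (rule cubeD[OF subsetD[OF assms(2) x(1)]])
        then show "- x i = -1 \<or> - x i = 1" by auto
      qed
      then show "y \<in> cube I" using x by simp
    qed
  next
    fix x y assume x: "x \<in> A" and "y \<in> neg ` A"
    then obtain z where z: "z \<in> A" "y = neg z" by auto
    have "{i \<in> I. x i \<noteq> y i} = {i \<in> I. x i = z i}"
    proof -
      have "x i \<noteq> y i \<longleftrightarrow> x i = z i" if i: "i \<in> I" for i
      proof -
        have "x i = -1 \<or> x i = 1" "z i = -1 \<or> z i = 1"
          using cubeD[OF subsetD[OF assms(2) x] i] cubeD[OF subsetD[OF assms(2) z(1)] i] .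
        moreover have "y i = - z i" using z(2) i by (simp add: neg_def)
        ultimately show ?thesis by (elim disjE) simp_all
      qed
      then show ?thesis by blast
    qed
    then show "real k \<le> real (card {i \<in> I. x i \<noteq> y i})" using far[OF x z(1)] by (simp add: agree_def)
  qed
  then have "(real (card A))\<^sup>2 \<le> exp (- t * real k) * (2 + exp t + exp (- t)) ^ card I"
    by (simp add: card_image[OF inj] power2_eq_square)
  also have "\<dots> \<le> exp (- t * real k) * (4 * exp (t\<^sup>2)) ^ card I"
  proof (intro mult_left_mono power_mono)
    have "1 \<le> exp (t\<^sup>2)" by simp
    then show "2 + exp t + exp (- t) \<le> 4 * exp (t\<^sup>2)" using exp_plus_exp_minus_le[OF t] by linarith
  qed (auto intro: add_nonneg_nonneg)
  also have "\<dots> = 4 ^ card I * exp (n * t\<^sup>2 - t * real k)"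
    by (simp add: power_mult_distrib exp_of_nat_mult[symmetric] n_def exp_diff exp_minus divide_inverse)
  also have "n * t\<^sup>2 - t * real k = 2 * (- (real k)\<^sup>2 / (8 * n))"
    using n by (simp add: t_def power2_eq_square field_simps)
  also have "4 ^ card I * exp (2 * (- (real k)\<^sup>2 / (8 * n))) = (exp (- (real k)\<^sup>2 / (8 * n)) * 2 ^ card I)\<^sup>2"
  proof -
    have "((2::real) ^ card I)\<^sup>2 = 4 ^ card I"
      by (simp add: power2_eq_square power_mult_distrib[symmetric])
    then show ?thesis by (simp only: exp_double power_mult_distrib mult.commute)
  qed
  finally show ?thesis unfolding n_def
    by (rule power2_le_imp_le) simp
qed

subsection \<open>Random bilinear forms\<close>

lemma sum_exp_cube:
  fixes c :: "'j \<Rightarrow> real"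
  assumes "finite J"
  shows "(\<Sum>M\<in>cube J. exp (t * (\<Sum>j\<in>J. M j * c j))) = (\<Prod>j\<in>J. exp (t * c j) + exp (- (t * c j)))"
proof -
  have "(\<Prod>j\<in>J. exp (t * c j) + exp (- (t * c j))) = (\<Prod>j\<in>J. \<Sum>s\<in>{-1, 1}. exp (t * (s * c j)))"
    by (intro prod.cong refl) simp
  also have "\<dots> = (\<Sum>M\<in>cube J. \<Prod>j\<in>J. exp (t * (M j * c j)))"
    unfolding cube_def by (intro prod_sum_PiE assms) simp
  also have "\<dots> = (\<Sum>M\<in>cube J. exp (t * (\<Sum>j\<in>J. M j * c j)))"
    by (simp add: exp_sum[OF assms] sum_distrib_left)
  finally show ?thesis by simp
qed

text \<open>Chernoff's method: Markov's inequality for the exponential moment, which factors over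
  the independent signs. A zero coefficient contributes exactly the factor 2.\<close>

lemma card_sign_sum_ge_le:
  fixes c :: "'j \<Rightarrow> real"
  assumes "finite J" and "\<And>j. j \<in> J \<Longrightarrow> c j \<in> {-1, 0, 1}" and "0 \<le> t" "t \<le> 1"
    and "(\<Sum>j\<in>J. (c j)\<^sup>2) \<le> K"
  shows "real (card {M \<in> cube J. L \<le> (\<Sum>j\<in>J. M j * c j)}) \<le> 2 ^ card J * exp (t\<^sup>2 * K - t * L)"
proof -
  let ?E = "{M \<in> cube J. L \<le> (\<Sum>j\<in>J. M j * c j)}"
  have "real (card ?E) * exp (t * L) = (\<Sum>M\<in>?E. exp (t * L))" by simp
  also have "\<dots> \<le> (\<Sum>M\<in>?E. exp (t * (\<Sum>j\<in>J. M j * c j)))"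
    using assms(3) by (intro sum_mono) (auto intro!: mult_left_mono)
  also have "\<dots> \<le> (\<Sum>M\<in>cube J. exp (t * (\<Sum>j\<in>J. M j * c j)))"
    using finite_cube[OF assms(1)] by (intro sum_mono2) auto
  also have "\<dots> = (\<Prod>j\<in>J. exp (t * c j) + exp (- (t * c j)))" by (rule sum_exp_cube[OF assms(1)])
  also have "\<dots> \<le> (\<Prod>j\<in>J. 2 * exp (t\<^sup>2 * (c j)\<^sup>2))"
  proof (intro prod_mono conjI)
    fix j assume "j \<in> J"
    then have "c j = -1 \<or> c j = 0 \<or> c j = 1" using assms(2)[of j] by auto
    then show "exp (t * c j) + exp (- (t * c j)) \<le> 2 * exp (t\<^sup>2 * (c j)\<^sup>2)"
      using exp_plus_exp_minus_le[OF assms(3,4)] by (auto simp: add.commute)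
  qed (simp add: add_nonneg_nonneg)
  also have "\<dots> = 2 ^ card J * exp (t\<^sup>2 * (\<Sum>j\<in>J. (c j)\<^sup>2))"
    by (simp add: prod.distrib exp_sum[OF assms(1)] sum_distrib_left)
  also have "\<dots> \<le> 2 ^ card J * exp (t\<^sup>2 * K)"
    using assms(5) by (intro mult_left_mono) (auto intro!: mult_left_mono)
  finally show ?thesis
    by (simp add: exp_diff field_simps)
qed

section \<open>Sparse sign vectors and the union bound over pairs of them\<close>

definition sparse :: "'i set \<Rightarrow> real \<Rightarrow> ('i \<Rightarrow> real) set" where
  "sparse I k = {u \<in> I \<rightarrow>\<^sub>E {-1, 0, 1}. (\<Sum>i\<in>I. (u i)\<^sup>2) \<le> k}"

lemma finite_sparse: "finite I \<Longrightarrow> finite (sparse I k)"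
  by (simp add: sparse_def finite_PiE)

text \<open>For entries in {-1, 0, 1} the sum of squares is the size of the support. Weighting each
  vector by \<open>exp (- l)\<close> per nonzero entry and rescaling by \<open>exp (l * k)\<close>
  makes every sparse vector count at least 1, while the sum over all vectors factors.\<close>

lemma card_sparse_le:
  assumes "finite I" "0 \<le> l"
  shows "real (card (sparse I k)) \<le> exp (l * k + 2 * real (card I) * exp (- l))"
proof -
  have "real (card (sparse I k)) = (\<Sum>u\<in>sparse I k. 1)" by simp
  also have "\<dots> \<le> (\<Sum>u\<in>sparse I k. exp (l * k) * (\<Prod>i\<in>I. exp (- l * (u i)\<^sup>2)))"
  proof (rule sum_mono)
    fix u assume "u \<in> sparse I k"
    then have "(\<Sum>i\<in>I. (u i)\<^sup>2) \<le> k" by (simp add: sparse_def)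
    then have "l * (\<Sum>i\<in>I. (u i)\<^sup>2) \<le> l * k" using assms(2) by (rule mult_left_mono)
    then show "1 \<le> exp (l * k) * (\<Prod>i\<in>I. exp (- l * (u i)\<^sup>2))"
      by (simp add: exp_sum[OF assms(1), symmetric] exp_add[symmetric] sum_negf sum_distrib_left)
  qed
  also have "\<dots> \<le> (\<Sum>u\<in>I \<rightarrow>\<^sub>E {-1, 0, 1}. exp (l * k) * (\<Prod>i\<in>I. exp (- l * (u i)\<^sup>2)))"
    using assms(1) by (intro sum_mono2) (auto simp: sparse_def finite_PiE intro!: mult_nonneg_nonneg prod_nonneg)
  also have "\<dots> = exp (l * k) * (\<Prod>i\<in>I. \<Sum>s\<in>{-1, 0, 1}. exp (- l * s\<^sup>2))"
    by (subst prod_sum_PiE) (use assms(1) in \<open>simp_all add: sum_distrib_left\<close>)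
  also have "\<dots> = exp (l * k) * (1 + 2 * exp (- l)) ^ card I"
    by (simp add: algebra_simps)
  also have "\<dots> \<le> exp (l * k) * exp (2 * exp (- l)) ^ card I"
    by (intro mult_left_mono power_mono) (auto intro: add_nonneg_nonneg)
  also have "\<dots> = exp (l * k + 2 * real (card I) * exp (- l))"
    by (simp add: exp_add exp_of_nat_mult[symmetric] mult_ac)
  finally show ?thesis .
qed

definition bil :: "'i set \<Rightarrow> ('i \<times> 'i \<Rightarrow> real) \<Rightarrow> ('i \<Rightarrow> real) \<Rightarrow> ('i \<Rightarrow> real) \<Rightarrow> real" where
  "bil I M x y = (\<Sum>p\<in>I \<times> I. M p * (x (fst p) * y (snd p)))"

text \<open>The event kept from the random choice of matrix: on it the exclusion of K_4 holds with
  certainty, not only with high probability.\<close>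

definition tame :: "'i set \<Rightarrow> real \<Rightarrow> real \<Rightarrow> ('i \<times> 'i \<Rightarrow> real) set" where
  "tame I k L = {M \<in> cube (I \<times> I). \<forall>u\<in>sparse I k. \<forall>v\<in>sparse I k. bil I M u v < L}"

text \<open>Union bound: the square of the number of sparse vectors times the Chernoff estimate for
  a single pair.\<close>

lemma card_not_tame_le:
  assumes "finite I" "0 \<le> l" "0 \<le> t" "t \<le> 1"
  shows "real (card (cube (I \<times> I) - tame I k L)) \<le> 2 ^ (card I * card I) *
    exp (2 * l * k + 4 * real (card I) * exp (- l) + t\<^sup>2 * k\<^sup>2 - t * L)"
proof -
  let ?S = "sparse I k" and ?b = "2 ^ (card I * card I) * exp (t\<^sup>2 * k\<^sup>2 - t * L)"
  let ?E = "\<lambda>p. {M \<in> cube (I \<times> I). L \<le> bil I M (fst p) (snd p)}"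
  have "cube (I \<times> I) - tame I k L = (\<Union>p\<in>?S \<times> ?S. ?E p)"
    by (force simp: tame_def not_less)
  then have "real (card (cube (I \<times> I) - tame I k L)) \<le> real (\<Sum>p\<in>?S \<times> ?S. card (?E p))"
    using card_UN_le[of "?S \<times> ?S" ?E] finite_sparse[OF assms(1)] by (simp del: of_nat_sum)
  also have "\<dots> \<le> (\<Sum>p\<in>?S \<times> ?S. ?b)"
    unfolding of_nat_sum
  proof (rule sum_mono)
    fix p assume "p \<in> ?S \<times> ?S"
    then obtain u v where p: "p = (u, v)" and uv: "u \<in> ?S" "v \<in> ?S" by auto
    let ?c = "\<lambda>q. u (fst q) * v (snd q)"
    have "real (card {M \<in> cube (I \<times> I). L \<le> (\<Sum>q\<in>I \<times> I. M q * ?c q)})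
        \<le> 2 ^ card (I \<times> I) * exp (t\<^sup>2 * k\<^sup>2 - t * L)"
    proof (rule card_sign_sum_ge_le)
      fix q assume "q \<in> I \<times> I"
      then have "u (fst q) \<in> {-1, 0, 1}" "v (snd q) \<in> {-1, 0, 1}" using uv by (auto simp: sparse_def)
      then show "?c q \<in> {-1, 0, 1}" by auto
    next
      \<comment> \<open>The matrix of products of entries of \<open>u\<close> and \<open>v\<close>
        has as many nonzero entries as the product of the two support sizes.\<close>
      have "(\<Sum>q\<in>I \<times> I. (?c q)\<^sup>2) = (\<Sum>i\<in>I. (u i)\<^sup>2) * (\<Sum>j\<in>I. (v j)\<^sup>2)"
        by (simp add: sum_product sum.cartesian_product power_mult_distrib case_prod_unfold)
      also have "\<dots> \<le> k * k"
      proof (intro mult_mono)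
        show u: "(\<Sum>i\<in>I. (u i)\<^sup>2) \<le> k" and "(\<Sum>i\<in>I. (v i)\<^sup>2) \<le> k" using uv by (auto simp: sparse_def)
        \<comment> \<open>The sign of \<open>k\<close> is read off from the existence of a sparse
          vector.\<close>
        show "0 \<le> k" using order_trans[OF sum_nonneg u] by simp
      qed (simp add: sum_nonneg)
      finally show "(\<Sum>q\<in>I \<times> I. (?c q)\<^sup>2) \<le> k\<^sup>2" by (simp add: power2_eq_square)
    qed (use assms in auto)
    then show "real (card (?E p)) \<le> ?b" by (simp add: p bil_def card_cartesian_product)
  qed
  also have "\<dots> = (real (card ?S))\<^sup>2 * ?b"
    by (simp add: card_cartesian_product power2_eq_square)
  also have "\<dots> \<le> (exp (l * k + 2 * real (card I) * exp (- l)))\<^sup>2 * ?b"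
    by (intro mult_right_mono power_mono card_sparse_le assms) auto
  also have "\<dots> = 2 ^ (card I * card I) *
      exp (2 * l * k + 4 * real (card I) * exp (- l) + t\<^sup>2 * k\<^sup>2 - t * L)"
    by (simp add: exp_double[symmetric] exp_add[symmetric] algebra_simps)
  finally show ?thesis .
qed

text \<open>The half sum vanishes where the two points differ and is a sign where they agree, so its
  support has size \<open>agree I x x'\<close>.\<close>

lemma half_sum_sparse:
  assumes "finite I" "x \<in> cube I" "x' \<in> cube I" "real (agree I x x') \<le> k"
  shows "restrict (\<lambda>i. (x i + x' i) / 2) I \<in> sparse I k"
proof -
  have s: "((x i + x' i) / 2)\<^sup>2 = (if x i = x' i then 1 else 0) \<and> (x i + x' i) / 2 \<in> {-1, 0, 1}"
    if "i \<in> I" for i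
    using cubeD[OF assms(2) that] cubeD[OF assms(3) that] by auto
  have "(\<Sum>i\<in>I. ((x i + x' i) / 2)\<^sup>2) = (\<Sum>i\<in>I. if x i = x' i then 1 else 0)"
    using s by (intro sum.cong) auto
  also have "\<dots> = real (agree I x x')"
    using assms(1) by (simp add: agree_def sum.If_cases Int_def)
  finally show ?thesis using assms(4) s by (auto simp: sparse_def)
qed

text \<open>Adding up the four values gives \<open>4 * bil M u v\<close> for the sparse half sums \<open>u\<close> of \<open>x, x'\<close>
  and \<open>v\<close> of \<open>y, y'\<close>.\<close>

lemma tame_no_K4:
  assumes "finite I" "M \<in> tame I k L" "x \<in> cube I" "x' \<in> cube I" "y \<in> cube I" "y' \<in> cube I"
    and "real (agree I x x') \<le> k" "real (agree I y y') \<le> k"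
    and "L \<le> bil I M x y" "L \<le> bil I M x y'" "L \<le> bil I M x' y" "L \<le> bil I M x' y'"
  shows False
proof -
  let ?u = "restrict (\<lambda>i. (x i + x' i) / 2) I" and ?v = "restrict (\<lambda>i. (y i + y' i) / 2) I"
  have "bil I M x y + bil I M x y' + bil I M x' y + bil I M x' y' = 4 * bil I M ?u ?v"
    unfolding bil_def sum.distrib[symmetric] sum_distrib_left
    by (intro sum.cong refl) (auto simp: algebra_simps add_divide_distrib)
  moreover have "bil I M ?u ?v < L"
    using assms half_sum_sparse unfolding tame_def by blast
  ultimately show False using assms by linarith
qed

section \<open>Anticoncentration of sign sums\<close>

lemma central_binomial_sq_le: "(real ((2 * r) choose r))\<^sup>2 * real (2 * r + 1) \<le> 16 ^ r"
proof (induction r)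
  case (Suc r)
  have c: "real ((2 * r) choose r) = fact (2 * r) / (fact r)\<^sup>2" for r
    by (simp add: binomial_fact power2_eq_square mult_2)
  define a where "a = real ((2 * r) choose r)"
  \<comment> \<open>The ratio of consecutive central binomial coefficients,
    \<open>2 * (2 * r + 1) / (r + 1)\<close>, cleared of its denominator.\<close>
  have e: "real ((2 * Suc r) choose (Suc r)) * (real r + 1) = a * (2 * (2 * real r + 1))"
  proof -
    have alg: "(R + R + 2) * (2 * R + 1) * F / ((R + 1) * g)\<^sup>2 * (R + 1) = F / g\<^sup>2 * (2 * (2 * R + 1))"
      if "R + 1 \<noteq> 0" "g \<noteq> 0" for R F g :: real
      using that by (simp add: power2_eq_square divide_simps) (simp add: algebra_simps)
    have f: "fact (2 * Suc r) = (real r + real r + 2) * (2 * real r + 1) * fact (2 * r)"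
      "fact (Suc r) = (real r + 1) * fact r"
      by (simp_all add: algebra_simps)
    show ?thesis unfolding a_def c f by (rule alg) (auto simp: add_eq_0_iff)
  qed
  have "(real ((2 * Suc r) choose (Suc r)))\<^sup>2 * real (2 * Suc r + 1) * (real r + 1)\<^sup>2
      = (real ((2 * Suc r) choose (Suc r)) * (real r + 1))\<^sup>2 * (2 * real r + 3)"
  proof -
    have "real (2 * Suc r + 1) = 2 * real r + 3" by simp
    then show ?thesis by (simp only: power_mult_distrib mult_ac)
  qed
  also have "\<dots> = (a\<^sup>2 * (2 * real r + 1)) * (4 * ((2 * real r + 1) * (2 * real r + 3)))"
    unfolding e by (simp add: power2_eq_square algebra_simps)
  also have "\<dots> \<le> 16 ^ r * (16 * (real r + 1)\<^sup>2)"
  proof (rule mult_mono)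
    show "a\<^sup>2 * (2 * real r + 1) \<le> 16 ^ r" using Suc.IH unfolding a_def by (simp add: algebra_simps)
    \<comment> \<open>Here \<open>(2 * r + 1) * (2 * r + 3)\<close> is one less than
      \<open>4 * (r + 1)\<^sup>2\<close>; this is why the factor \<open>2 * r + 1\<close> is carried
      along.\<close>
    show "4 * ((2 * real r + 1) * (2 * real r + 3)) \<le> 16 * (real r + 1)\<^sup>2"
      by (simp add: power2_eq_square algebra_simps)
  qed auto
  finally have "(real ((2 * Suc r) choose (Suc r)))\<^sup>2 * real (2 * Suc r + 1) * (real r + 1)\<^sup>2
      \<le> 16 ^ Suc r * (real r + 1)\<^sup>2" by simp
  then show ?case by (subst (asm) mult_le_cancel_right_pos) auto
qed simp

text \<open>For even \<open>m\<close> the central coefficient dominates. For odd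
  \<open>m = 2 * r + 1\<close> Pascal's rule splits the coefficient into two of row
  \<open>2 * r\<close>; bounding these with the root of \<open>2 * r + 1\<close> loses nothing.
  Pascal's rule needs a positive lower index, so \<open>j = 0\<close> is separate.\<close>

lemma binomial_sqrt_le: "real (m choose j) * sqrt (real m) \<le> 2 ^ m"
proof -
  have c: "real ((2 * r) choose r) * sqrt (real (2 * r + 1)) \<le> 4 ^ r" for r
  proof (rule power2_le_imp_le)
    have "(4 ^ r :: real)\<^sup>2 = 16 ^ r" by (simp add: power2_eq_square power_mult_distrib[symmetric])
    then show "(real ((2 * r) choose r) * sqrt (real (2 * r + 1)))\<^sup>2 \<le> (4 ^ r)\<^sup>2"
      using central_binomial_sq_le[of r] by (simp add: power_mult_distrib)
  qed simp
  have ev: "real ((2 * r) choose j) * sqrt (real (2 * r + 1)) \<le> 4 ^ r" for r j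
  proof -
    have "real ((2 * r) choose j) * sqrt (real (2 * r + 1)) \<le> real ((2 * r) choose r) * sqrt (real (2 * r + 1))"
      using binomial_maximum'[of r j] by (intro mult_right_mono) auto
    then show ?thesis using c[of r] by linarith
  qed
  have p4: "(2::real) ^ (2 * r) = 4 ^ r" for r by (simp add: power_mult)
  show ?thesis
  proof (cases "even m")
    case True
    then obtain r where r: "m = 2 * r" by auto
    have "real (m choose j) * sqrt (real m) \<le> real ((2 * r) choose j) * sqrt (real (2 * r + 1))"
      unfolding r by (intro mult_left_mono) auto
    then show ?thesis using ev[of r j] unfolding r p4 by linarith
  next
    case False
    then obtain r where r: "m = 2 * r + 1" by (auto elim: oddE)
    show ?thesis
    proof (cases j)
      case 0
      have "sqrt (real m) \<le> sqrt ((real m)\<^sup>2)" by (intro real_sqrt_le_mono self_le_power) (auto simp: r)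
      also have "\<dots> \<le> 2 ^ m" using less_exp[of m] by (simp add: less_imp_le)
      finally show ?thesis using 0 by simp
    next
      case (Suc i)
      have "real (m choose j) * sqrt (real m)
          = real ((2 * r) choose i) * sqrt (real (2 * r + 1)) + real ((2 * r) choose (Suc i)) * sqrt (real (2 * r + 1))"
        unfolding r Suc by (simp add: algebra_simps)
      then show ?thesis using ev[of r i] ev[of r "Suc i"] unfolding r by (simp add: p4)
    qed
  qed
qed

lemma card_sign_sum_eq_le:
  assumes "finite J"
  shows "card {M \<in> cube J. card {j \<in> J. M j = 1} = r} \<le> card J choose r"
proof -
  have "inj_on (\<lambda>M. {j \<in> J. M j = 1}) {M \<in> cube J. card {j \<in> J. M j = 1} = r}"
  proof (rule inj_onI)
    fix M M' assume M: "M \<in> {M \<in> cube J. card {j \<in> J. M j = 1} = r}"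
      "M' \<in> {M \<in> cube J. card {j \<in> J. M j = 1} = r}" "{j \<in> J. M j = 1} = {j \<in> J. M' j = 1}"
    show "M = M'"
    proof (rule cube_eqI)
      fix j assume j: "j \<in> J"
      have "M j = 1 \<longleftrightarrow> M' j = 1" using M(3) j by blast
      then show "M j = M' j" using M(1,2) cubeD[of M J j] cubeD[of M' J j] j by auto
    qed (use M in auto)
  qed
  then have "card {M \<in> cube J. card {j \<in> J. M j = 1} = r} \<le> card {S. S \<subseteq> J \<and> card S = r}"
    by (rule card_inj_on_le) (use assms in auto)
  then show ?thesis using n_subsets[OF assms] by simp
qed

lemma sum_cube_eq:
  assumes "finite J" "M \<in> cube J"
  shows "(\<Sum>j\<in>J. M j) = 2 * real (card {j \<in> J. M j = 1}) - real (card J)"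
proof -
  have "(\<Sum>j\<in>J. M j) = (\<Sum>j\<in>J. 2 * (if M j = 1 then 1 else 0) - 1)"
    using cubeD[OF assms(2)] by (intro sum.cong) auto
  then show ?thesis using assms(1)
    by (simp add: sum_subtractf sum_distrib_left[symmetric] sum.If_cases Int_def)
qed

text \<open>The admissible \<open>r\<close> lie in an open interval of length \<open>L\<close>, so
  counted from the least one there are at most \<open>\<lfloor>L\<rfloor> + 1\<close> of
  them.\<close>

lemma card_nat_interval_le:
  assumes "0 \<le> (L::real)"
  shows "finite {r::nat. \<bar>2 * real r - m\<bar> < L} \<and> real (card {r::nat. \<bar>2 * real r - m\<bar> < L}) \<le> L + 1"
proof (cases "{r::nat. \<bar>2 * real r - m\<bar> < L} = {}")
  case False
  define T where "T = {r::nat. \<bar>2 * real r - m\<bar> < L}"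
  define a where "a = (LEAST r. r \<in> T)"
  have a: "a \<in> T" "\<And>r. r \<in> T \<Longrightarrow> a \<le> r"
    using False unfolding a_def T_def[symmetric] by (auto intro: LeastI Least_le)
  have "T \<subseteq> {a..a + nat \<lfloor>L\<rfloor>}"
  proof
    fix r assume r: "r \<in> T"
    then have "\<bar>2 * real r - m\<bar> < L" "\<bar>2 * real a - m\<bar> < L" "a \<le> r" using a by (simp_all add: T_def)
    then have "real (r - a) \<le> L" by linarith
    then have "r - a \<le> nat \<lfloor>L\<rfloor>" by (rule le_nat_floor)
    then show "r \<in> {a..a + nat \<lfloor>L\<rfloor>}" using \<open>a \<le> r\<close> by simp
  qed
  then have "finite T" "card T \<le> card {a..a + nat \<lfloor>L\<rfloor>}"
    using finite_subset card_mono finite_atLeastAtMost by blast+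
  moreover have "real (nat \<lfloor>L\<rfloor>) \<le> L" using assms by simp
  ultimately show ?thesis unfolding T_def[symmetric] by simp
qed (use assms in simp)

text \<open>Negation maps the lower tail injectively into the upper one, so the upper tail has at
  least half of what the window around 0 leaves. That window contains few values of the sum, each
  rare by the binomial bound.\<close>

lemma card_sign_sum_ge_ge:
  assumes "finite J" "J \<noteq> {}" "0 \<le> L"
  shows "2 ^ card J * (1/2 - (L + 1) / (2 * sqrt (real (card J)))) \<le>
    real (card {M \<in> cube J. L \<le> (\<Sum>j\<in>J. M j)})"
proof -
  let ?m = "card J"
  let ?P = "{M \<in> cube J. L \<le> (\<Sum>j\<in>J. M j)}" and ?N = "{M \<in> cube J. (\<Sum>j\<in>J. M j) \<le> - L}"
  let ?Z = "{M \<in> cube J. \<bar>\<Sum>j\<in>J. M j\<bar> < L}"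
  have m: "sqrt (real ?m) > 0" using assms by (simp add: card_gt_0_iff)
  have half_diff_le: "(q - Y) / 2 \<le> P" if "z \<le> Y" "q \<le> 2 * P + z" for q Y P z :: real
    using that by simp
  define T where "T = {r::nat. \<bar>2 * real r - real ?m\<bar> < L}"
  have T: "finite T" "real (card T) \<le> L + 1" using card_nat_interval_le[OF assms(3)] by (auto simp: T_def)
  \<comment> \<open>With \<open>r\<close> entries equal to 1 the sum is
    \<open>2 * r - card J\<close>, so \<open>T\<close> indexes the values inside the window.\<close>
  have "?Z \<subseteq> (\<Union>r\<in>T. {M \<in> cube J. card {j \<in> J. M j = 1} = r})"
    using sum_cube_eq[OF assms(1)] by (auto simp: T_def)
  then have "card ?Z \<le> card (\<Union>r\<in>T. {M \<in> cube J. card {j \<in> J. M j = 1} = r})"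
    by (intro card_mono) (use T finite_cube[OF assms(1)] in auto)
  also have "\<dots> \<le> (\<Sum>r\<in>T. card {M \<in> cube J. card {j \<in> J. M j = 1} = r})"
    using T by (intro card_UN_le)
  finally have "real (card ?Z) \<le> real (\<Sum>r\<in>T. card {M \<in> cube J. card {j \<in> J. M j = 1} = r})"
    by (simp only: of_nat_le_iff)
  also have "\<dots> \<le> (\<Sum>r\<in>T. 2 ^ ?m / sqrt (real ?m))" unfolding of_nat_sum
  proof (rule sum_mono)
    fix r
    have "real (card {M \<in> cube J. card {j \<in> J. M j = 1} = r}) \<le> real (?m choose r)"
      using card_sign_sum_eq_le[OF assms(1)] by simp
    also have "\<dots> \<le> 2 ^ ?m / sqrt (real ?m)" using binomial_sqrt_le[of ?m r] m by (simp add: field_simps)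
    finally show "real (card {M \<in> cube J. card {j \<in> J. M j = 1} = r}) \<le> 2 ^ ?m / sqrt (real ?m)" .
  qed
  also have "\<dots> \<le> (L + 1) * (2 ^ ?m / sqrt (real ?m))"
    using T(2) m by (simp only: sum_constant) (intro mult_right_mono, auto)
  finally have Z: "real (card ?Z) \<le> (L + 1) * (2 ^ ?m / sqrt (real ?m))" .
  have "card ?N \<le> card ?P"
  proof (rule card_inj_on_le[where f = "\<lambda>M. restrict (\<lambda>j. - M j) J"])
    show "inj_on (\<lambda>M. restrict (\<lambda>j. - M j) J) ?N"
    proof (rule inj_onI)
      fix M M' assume M: "M \<in> ?N" "M' \<in> ?N" "restrict (\<lambda>j. - M j) J = restrict (\<lambda>j. - M' j) J"
      show "M = M'"
      proof (rule cube_eqI)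
        fix j assume "j \<in> J"
        then show "M j = M' j" using fun_cong[OF M(3), of j] by simp
      qed (use M in auto)
    qed
    show "(\<lambda>M. restrict (\<lambda>j. - M j) J) ` ?N \<subseteq> ?P"
    proof
      fix M' assume "M' \<in> (\<lambda>M. restrict (\<lambda>j. - M j) J) ` ?N"
      then obtain M where M: "M \<in> ?N" "M' = restrict (\<lambda>j. - M j) J" by auto
      have "restrict (\<lambda>j. - M j) J \<in> cube J"
      proof (rule restrict_in_cube)
        fix j assume "j \<in> J"
        then have "M j = -1 \<or> M j = 1" using cubeD[of M J j] M(1) by simp
        then show "- M j = -1 \<or> - M j = 1" by auto
      qed
      then show "M' \<in> ?P" using M by (simp add: sum_negf)
    qed
  qed (use finite_cube[OF assms(1)] in auto)
  moreover have "2 ^ ?m \<le> card ?P + card ?N + card ?Z"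
  proof -
    have "cube J \<subseteq> ?P \<union> ?N \<union> ?Z" by auto
    then have "card (cube J) \<le> card (?P \<union> ?N \<union> ?Z)"
      using finite_cube[OF assms(1)] by (intro card_mono) auto
    also have "\<dots> \<le> card ?P + card ?N + card ?Z"
      by (meson add_mono card_Un_le le_refl order_trans)
    finally show ?thesis using card_cube[OF assms(1)] by simp
  qed
  ultimately have "2 ^ ?m \<le> 2 * card ?P + card ?Z" by linarith
  then have "real (2 ^ ?m) \<le> real (2 * card ?P + card ?Z)" by (simp only: of_nat_le_iff)
  then have "(2::real) ^ ?m \<le> 2 * real (card ?P) + real (card ?Z)" by simp
  with Z have "(2 ^ ?m - (L + 1) * (2 ^ ?m / sqrt (real ?m))) / 2 \<le> real (card ?P)"
    by (rule half_diff_le)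
  moreover have "2 ^ ?m * (1/2 - (L + 1) / (2 * sqrt (real ?m))) = (2 ^ ?m - (L + 1) * (2 ^ ?m / sqrt (real ?m))) / 2"
    using m by (simp add: field_simps)
  ultimately show ?thesis by simp
qed

text \<open>Multiplying the entry at \<open>(i, j)\<close> by the sign \<open>x i * y j\<close>
  permutes the sign matrices and turns the plain sum of entries into the bilinear form, so the
  estimate for sign sums applies to every pair \<open>x\<close>, \<open>y\<close>. The root of the
  number of entries is \<open>card I\<close>.\<close>

lemma card_bil_ge_ge:
  assumes "finite I" "I \<noteq> {}" "0 \<le> L" "x \<in> cube I" "y \<in> cube I"
  shows "2 ^ (card I * card I) * (1/2 - (L + 1) / (2 * real (card I))) \<le>
    real (card {M \<in> cube (I \<times> I). L \<le> bil I M x y})"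
proof -
  let ?J = "I \<times> I"
  let ?g = "\<lambda>M. restrict (\<lambda>p. M p * (x (fst p) * y (snd p))) ?J"
  have sq: "(x (fst p) * y (snd p)) * (x (fst p) * y (snd p)) = 1" if "p \<in> ?J" for p
    using cubeD[OF assms(4), of "fst p"] cubeD[OF assms(5), of "snd p"] that by auto
  have "card {M \<in> cube ?J. L \<le> (\<Sum>p\<in>?J. M p)} \<le> card {M \<in> cube ?J. L \<le> bil I M x y}"
  proof (rule card_inj_on_le[where f = ?g])
    show "inj_on ?g {M \<in> cube ?J. L \<le> (\<Sum>p\<in>?J. M p)}"
    proof (rule inj_onI)
      fix M M' assume M: "M \<in> {M \<in> cube ?J. L \<le> (\<Sum>p\<in>?J. M p)}"
        "M' \<in> {M \<in> cube ?J. L \<le> (\<Sum>p\<in>?J. M p)}" "?g M = ?g M'"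
      show "M = M'"
      proof (rule cube_eqI)
        fix p assume p: "p \<in> ?J"
        have "M p * (x (fst p) * y (snd p)) = M' p * (x (fst p) * y (snd p))"
          using fun_cong[OF M(3), of p] p by simp
        moreover have "x (fst p) * y (snd p) \<noteq> 0" using sq[OF p] by auto
        ultimately show "M p = M' p" by simp
      qed (use M in auto)
    qed
    have "bil I (?g M) x y = (\<Sum>p\<in>?J. M p)" for M
      unfolding bil_def
    proof (rule sum.cong[OF refl])
      fix p assume "p \<in> ?J"
      then show "?g M p * (x (fst p) * y (snd p)) = M p" using sq[of p] by (auto simp: mult.assoc)
    qed
    moreover have "?g M \<in> cube ?J" if M: "M \<in> cube ?J" for M
    proof (rule restrict_in_cube)
      fix p assume p: "p \<in> ?J"
      then have "fst p \<in> I" "snd p \<in> I" by auto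
      then show "M p * (x (fst p) * y (snd p)) = -1 \<or> M p * (x (fst p) * y (snd p)) = 1"
        using cubeD[OF M p] cubeD[OF assms(4), of "fst p"] cubeD[OF assms(5), of "snd p"] by auto
    qed
    ultimately show "?g ` {M \<in> cube ?J. L \<le> (\<Sum>p\<in>?J. M p)} \<subseteq> {M \<in> cube ?J. L \<le> bil I M x y}" by auto
  qed (use finite_cube[of ?J] assms(1) in auto)
  moreover have "2 ^ card ?J * (1/2 - (L + 1) / (2 * sqrt (real (card ?J)))) \<le>
    real (card {M \<in> cube ?J. L \<le> (\<Sum>j\<in>?J. M j)})"
    by (rule card_sign_sum_ge_ge) (use assms in auto)
  moreover have "sqrt (real (card ?J)) = real (card I)"
    by (simp add: card_cartesian_product real_sqrt_mult)
  ultimately show ?thesis by (simp add: card_cartesian_product)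
qed

subsection \<open>The Bollobas--Erdos gadget\<close>

text \<open>All that the blow-up uses. \<open>H\<close> is the graph inside a class and
  \<open>F M\<close> the bipartite graph between two copies of \<open>X\<close>. The copies are
  distinct, so \<open>x\<close> and \<open>y\<close> may be the same point; \<open>F M\<close> need
  not be symmetric, so the order of the two classes matters.\<close>

locale ramsey_turan_gadget =
  fixes X :: "'x set" and H :: "'x \<Rightarrow> 'x \<Rightarrow> bool" and \<M> :: "'m set"
    and F :: "'m \<Rightarrow> 'x \<Rightarrow> 'x \<Rightarrow> bool" and \<delta> \<eta> :: real
  assumes finite_X: "finite X" and X_nonempty: "X \<noteq> {}"
    and finite_M: "finite \<M>" and M_nonempty: "\<M> \<noteq> {}"
    and H_irrefl: "x \<in> X \<Longrightarrow> \<not> H x x" and H_sym: "H x y \<Longrightarrow> H y x"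
    and H_triangle_free: "x \<in> X \<Longrightarrow> y \<in> X \<Longrightarrow> z \<in> X \<Longrightarrow> H x y \<Longrightarrow> H y z \<Longrightarrow> \<not> H x z"
    and H_independent: "A \<subseteq> X \<Longrightarrow> (\<And>x y. x \<in> A \<Longrightarrow> y \<in> A \<Longrightarrow> \<not> H x y) \<Longrightarrow>
      real (card A) \<le> \<delta> * real (card X)"
    and F_no_K4: "M \<in> \<M> \<Longrightarrow> x \<in> X \<Longrightarrow> x' \<in> X \<Longrightarrow> y \<in> X \<Longrightarrow> y' \<in> X \<Longrightarrow> H x x' \<Longrightarrow> H y y' \<Longrightarrow>
      \<not> (F M x y \<and> F M x y' \<and> F M x' y \<and> F M x' y')"
    and F_dense: "x \<in> X \<Longrightarrow> y \<in> X \<Longrightarrow> (1/2 - \<eta>) * real (card \<M>) \<le> real (card {M \<in> \<M>. F M x y})"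

text \<open>Among three signs two coincide. With \<open>3 * k \<le> card I\<close>, three points
  therefore cannot pairwise agree in fewer than \<open>k\<close> coordinates.\<close>

lemma agree_three:
  assumes "finite I" "x \<in> cube I" "y \<in> cube I" "z \<in> cube I"
  shows "card I \<le> agree I x y + agree I y z + agree I x z"
proof -
  have "I \<subseteq> {i \<in> I. x i = y i} \<union> {i \<in> I. y i = z i} \<union> {i \<in> I. x i = z i}"
  proof
    fix i assume i: "i \<in> I"
    then show "i \<in> {i \<in> I. x i = y i} \<union> {i \<in> I. y i = z i} \<union> {i \<in> I. x i = z i}"
      using cubeD[OF assms(2) i] cubeD[OF assms(3) i] cubeD[OF assms(4) i] by auto
  qed
  then have "card I \<le> card ({i \<in> I. x i = y i} \<union> {i \<in> I. y i = z i} \<union> {i \<in> I. x i = z i})"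
    using assms(1) by (intro card_mono) auto
  also have "\<dots> \<le> agree I x y + agree I y z + agree I x z"
    unfolding agree_def by (meson add_mono card_Un_le le_refl order_trans)
  finally show ?thesis .
qed

text \<open>The parameters are \<open>n = p ^ 8\<close>, \<open>k = w * p ^ 4\<close>,
  \<open>L = p ^ 7\<close>, with \<open>l = ln n\<close> and \<open>t = 1 / p ^ 2\<close> in the
  union bound. The summands are the anticoncentration loss and the bound for the share of matrices
  that are not tame; in the exponent, \<open>t * L = p ^ 5\<close> beats the other terms, of order
  at most \<open>p ^ 4 * ln p\<close>.\<close>

lemma gadget_parameters:
  fixes \<eta> :: real and w :: nat
  assumes "0 < \<eta>"
  shows "\<exists>p::nat. 0 < p \<and> 3 * (w * p ^ 4) \<le> p ^ 8 \<and>
    (real p ^ 7 + 1) / (2 * real p ^ 8) + exp (2 * ln (real p ^ 8) * (real w * real p ^ 4) +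
      4 * real p ^ 8 * exp (- ln (real p ^ 8)) + (1 / (real p)\<^sup>2)\<^sup>2 * (real w * real p ^ 4)\<^sup>2
      - 1 / (real p)\<^sup>2 * real p ^ 7) \<le> \<eta>"
proof -
  let ?f = "\<lambda>p::nat. (real p ^ 7 + 1) / (2 * real p ^ 8) + exp (2 * ln (real p ^ 8) * (real w * real p ^ 4) +
      4 * real p ^ 8 * exp (- ln (real p ^ 8)) + (1 / (real p)\<^sup>2)\<^sup>2 * (real w * real p ^ 4)\<^sup>2
      - 1 / (real p)\<^sup>2 * real p ^ 7)"
  have "?f \<longlonglongrightarrow> 0"
  proof (cases "w = 0")
    case True
    then show ?thesis by simp real_asymp
  next
    case False
    then have "real w > 0" by simp
    then show ?thesis by real_asymp
  qed
  then have "\<forall>\<^sub>F p in sequentially. ?f p < \<eta>" using assms by (rule order_tendstoD)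
  \<comment> \<open>The condition \<open>3 * w \<le> p\<close> yields \<open>3 * k \<le> n\<close>,
    needed for triangle-freeness.\<close>
  moreover have "\<forall>\<^sub>F p::nat in sequentially. 0 < p \<and> 3 * w \<le> p"
    by (intro eventually_conj eventually_gt_at_top eventually_ge_at_top)
  ultimately have "\<forall>\<^sub>F p in sequentially. ?f p < \<eta> \<and> 0 < p \<and> 3 * w \<le> p" by (rule eventually_conj)
  then obtain p where p: "?f p < \<eta>" "0 < p" "3 * w \<le> p" by (auto simp: eventually_sequentially)
  have "3 * (w * p ^ 4) = (3 * w) * p ^ 4" by simp
  also have "\<dots> \<le> p * p ^ 4" using p by (intro mult_right_mono) auto
  also have "\<dots> = p ^ 5" by (simp add: eval_nat_numeral)
  also have "\<dots> \<le> p ^ 8" using p by (intro power_increasing) auto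
  finally show ?thesis using p less_imp_le by blast
qed

lemma ramsey_turan_gadget_exists:
  fixes \<delta> \<eta> :: real
  assumes "0 < \<delta>" "0 < \<eta>" "\<eta> < 1/2"
  shows "\<exists>(X :: (nat \<Rightarrow> real) set) H (\<M> :: (nat \<times> nat \<Rightarrow> real) set) F. ramsey_turan_gadget X H \<M> F \<delta> \<eta>"
proof -
  \<comment> \<open>\<open>w\<close> is fixed before \<open>p\<close>: with
    \<open>k\<^sup>2 / n = w\<^sup>2\<close> the density bound for independent sets depends on
    \<open>w\<close> alone, which leaves \<open>p\<close> free to grow.\<close>
  have "((\<lambda>w::nat. exp (- (real w)\<^sup>2 / 8)) \<longlonglongrightarrow> 0)" by real_asymp
  then have "\<forall>\<^sub>F w in sequentially. exp (- (real w)\<^sup>2 / 8) < \<delta>" using assms(1) by (rule order_tendstoD)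
  then obtain w :: nat where w: "exp (- (real w)\<^sup>2 / 8) < \<delta>" by (auto simp: eventually_sequentially)
  obtain p :: nat where p: "0 < p" "3 * (w * p ^ 4) \<le> p ^ 8"
    and small: "(real p ^ 7 + 1) / (2 * real p ^ 8) + exp (2 * ln (real p ^ 8) * (real w * real p ^ 4) +
      4 * real p ^ 8 * exp (- ln (real p ^ 8)) + (1 / (real p)\<^sup>2)\<^sup>2 * (real w * real p ^ 4)\<^sup>2
      - 1 / (real p)\<^sup>2 * real p ^ 7) \<le> \<eta>"
    using gadget_parameters[OF assms(2)] by blast
  define n where "n = p ^ 8"
  define k where "k = w * p ^ 4"
  define L where "L = real p ^ 7"
  define I where "I = {..<n}"
  have n3: "0 < n" "3 * k \<le> n" unfolding n_def k_def by (rule zero_less_power[OF p(1)], rule p(2))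
  have I: "finite I" "card I = n" "I \<noteq> {}" using n3(1) by (simp_all add: I_def lessThan_empty_iff)
  define H :: "(nat \<Rightarrow> real) \<Rightarrow> (nat \<Rightarrow> real) \<Rightarrow> bool" where "H = (\<lambda>x y. agree I x y < k)"
  define \<M> where "\<M> = tame I (real k) L"
  define F where "F = (\<lambda>M x y. L \<le> bil I M x y)"
  have fin: "finite (cube (I \<times> I))" by (rule finite_cube[OF finite_cartesian_product[OF I(1) I(1)]])
  have M_sub: "\<M> \<subseteq> cube (I \<times> I)" by (auto simp: \<M>_def tame_def)
  have "card (cube (I \<times> I)) = 2 ^ (n * n)" using I by (simp add: card_cube card_cartesian_product)
  then have "card \<M> \<le> 2 ^ (n * n)" using card_mono[OF fin M_sub] by simp
  then have "real (card \<M>) \<le> real (2 ^ (n * n))" by (simp only: of_nat_le_iff)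
  then have card_M: "real (card \<M>) \<le> 2 ^ (n * n)" by simp
  define e where "e = exp (2 * ln (real n) * real k +
      4 * real n * exp (- ln (real n)) + (1 / (real p)\<^sup>2)\<^sup>2 * (real k)\<^sup>2 - 1 / (real p)\<^sup>2 * L)"
  have small': "(L + 1) / (2 * real n) + e \<le> \<eta>"
    using small by (simp only: e_def n_def k_def L_def of_nat_mult of_nat_power)
  have bad: "real (card (cube (I \<times> I) - \<M>)) \<le> 2 ^ (n * n) * e"
    unfolding e_def \<M>_def I(2)[symmetric]
  proof (rule card_not_tame_le[OF I(1)])
    show "0 \<le> ln (real (card I))" using I(2) n3(1) by simp
    have "1 \<le> (real p)\<^sup>2" using p(1) by simp
    then show "1 / (real p)\<^sup>2 \<le> 1" using p(1) by (subst divide_le_eq_1_pos) auto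
  qed simp
  \<comment> \<open>Measured against all sign matrices: those joining \<open>x\<close> and
    \<open>y\<close>, less all that are not tame. Passing to the smaller \<open>card \<M>\<close>
    later only weakens the bound.\<close>
  have dense: "(1/2 - \<eta>) * 2 ^ (n * n) \<le> real (card {M \<in> \<M>. F M x y})"
    if xy: "x \<in> cube I" "y \<in> cube I" for x y
  proof -
    have 1: "2 ^ (n * n) * (1/2 - (L + 1) / (2 * real n)) \<le> real (card {M \<in> cube (I \<times> I). F M x y})"
      unfolding F_def I(2)[symmetric] by (rule card_bil_ge_ge) (simp_all add: I xy L_def)
    have "card {M \<in> cube (I \<times> I). F M x y} \<le> card ({M \<in> \<M>. F M x y} \<union> (cube (I \<times> I) - \<M>))"
      using fin M_sub by (intro card_mono) (auto intro: finite_subset)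
    also have "\<dots> \<le> card {M \<in> \<M>. F M x y} + card (cube (I \<times> I) - \<M>)"
      by (rule card_Un_le)
    finally have "real (card {M \<in> cube (I \<times> I). F M x y})
        \<le> real (card {M \<in> \<M>. F M x y}) + real (card (cube (I \<times> I) - \<M>))"
      by (simp only: of_nat_add[symmetric] of_nat_le_iff)
    with 1 bad have "2 ^ (n * n) * (1/2 - (L + 1) / (2 * real n)) - 2 ^ (n * n) * e \<le> real (card {M \<in> \<M>. F M x y})"
      by linarith
    moreover have "2 ^ (n * n) * (1/2 - \<eta>) \<le> 2 ^ (n * n) * (1/2 - (L + 1) / (2 * real n) - e)"
      using small' by (intro mult_left_mono) auto
    ultimately show ?thesis by (simp only: right_diff_distrib mult.commute)
  qed
  have x0: "(\<lambda>i\<in>I. 1) \<in> cube I" by (auto simp: cube_def)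
  have "ramsey_turan_gadget (cube I) H \<M> F \<delta> \<eta>"
  proof
    show "finite (cube I)" by (rule finite_cube[OF I(1)])
    show "cube I \<noteq> {}" using x0 by blast
    show "finite \<M>" by (rule finite_subset[OF M_sub fin])
    \<comment> \<open>Density at a single pair already forces a tame matrix to exist, because
      \<open>\<eta> < 1/2\<close>.\<close>
    show "\<M> \<noteq> {}"
    proof
      assume "\<M> = {}"
      then have "(1/2 - \<eta>) * 2 ^ (n * n) \<le> 0" using dense[OF x0 x0] by simp
      moreover have "0 < (1/2 - \<eta>) * 2 ^ (n * n)" using assms(3) by (intro mult_pos_pos) auto
      ultimately show False by linarith
    qed
    show "\<not> H x x" for x using I n3 by (auto simp: H_def agree_def)
    show "H y x" if "H x y" for x y using that by (simp add: H_def agree_def eq_commute)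
    show "\<not> H x z" if "x \<in> cube I" "y \<in> cube I" "z \<in> cube I" "H x y" "H y z" for x y z
      using agree_three[OF I(1) that(1-3)] that n3 I by (auto simp: H_def)
    show "real (card A) \<le> \<delta> * real (card (cube I))"
      if A: "A \<subseteq> cube I" "\<And>x y. x \<in> A \<Longrightarrow> y \<in> A \<Longrightarrow> \<not> H x y" for A
    proof -
      have "real (card A) \<le> exp (- (real k)\<^sup>2 / (8 * real (card I))) * 2 ^ card I"
        by (rule card_no_near_antipodal_le) (use A I n3 in \<open>auto simp: H_def not_less\<close>)
      also have "- (real k)\<^sup>2 / (8 * real (card I)) = - (real w)\<^sup>2 / 8"
        using p I by (simp add: n_def k_def power_mult_distrib power_mult[symmetric])
      also have "exp (- (real w)\<^sup>2 / 8) * 2 ^ card I \<le> \<delta> * 2 ^ card I"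
        using w by (intro mult_right_mono) auto
      finally show ?thesis using I by (simp add: card_cube)
    qed
    show "\<not> (F M x y \<and> F M x y' \<and> F M x' y \<and> F M x' y')"
      if "M \<in> \<M>" "x \<in> cube I" "x' \<in> cube I" "y \<in> cube I" "y' \<in> cube I" "H x x'" "H y y'" for M x x' y y'
      using tame_no_K4[of I M "real k" L x x' y y'] that I by (auto simp: F_def H_def \<M>_def)
    show "(1/2 - \<eta>) * real (card \<M>) \<le> real (card {M \<in> \<M>. F M x y})"
      if "x \<in> cube I" "y \<in> cube I" for x y
    proof -
      have "(1/2 - \<eta>) * real (card \<M>) \<le> (1/2 - \<eta>) * 2 ^ (n * n)"
        using card_M assms(3) by (intro mult_left_mono) auto
      then show ?thesis using dense[OF that] by linarith
    qed
  qed
  then show ?thesis by blast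
qed

subsection \<open>Blowing up a weighted graph\<close>

text \<open>Every size but one is rounded down; the distinguished \<open>z\<close> absorbs the total
  rounding error, less than 1 for each other element.\<close>

lemma rounded_sizes_exist:
  fixes p :: "'y \<Rightarrow> real"
  assumes "finite Y" "Y \<noteq> {}" "\<And>y. y \<in> Y \<Longrightarrow> 0 \<le> p y" "(\<Sum>y\<in>Y. p y) = 1"
  shows "\<exists>a. (\<Sum>y\<in>Y. a y) = N \<and> (\<forall>y\<in>Y. \<bar>real (a y) - p y * real N\<bar> \<le> real (card Y))"
proof -
  obtain z where z: "z \<in> Y" using assms(2) by auto
  let ?Z = "Y - {z}"
  define b where "b = (\<lambda>y. nat \<lfloor>p y * real N\<rfloor>)"
  have b: "real (b y) \<le> p y * real N" "p y * real N \<le> real (b y) + 1" if "y \<in> Y" for y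
  proof -
    have "0 \<le> p y * real N" using assms(3)[OF that] by simp
    then show "real (b y) \<le> p y * real N" "p y * real N \<le> real (b y) + 1"
      unfolding b_def by linarith+
  qed
  have rest: "p z * real N + (\<Sum>y\<in>?Z. p y * real N) = real N"
    using assms(4) sum.remove[OF assms(1) z, of p] by (simp add: sum_distrib_right[symmetric] distrib_right[symmetric])
  have le: "(\<Sum>y\<in>?Z. real (b y)) \<le> (\<Sum>y\<in>?Z. p y * real N)"
    by (rule sum_mono) (simp add: b)
  have "(\<Sum>y\<in>?Z. p y * real N) \<le> (\<Sum>y\<in>?Z. real (b y) + 1)"
    by (rule sum_mono) (simp add: b)
  then have ge: "(\<Sum>y\<in>?Z. p y * real N) \<le> (\<Sum>y\<in>?Z. real (b y)) + real (card Y)"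
    using card_mono[OF assms(1), of ?Z] by (simp add: sum.distrib)
  have card1: "1 \<le> real (card Y)" using assms(1,2) by (simp add: Suc_le_eq card_gt_0_iff)
  have pz: "0 \<le> p z * real N" using assms(3)[OF z] by simp
  have "real (\<Sum>y\<in>?Z. b y) \<le> real N" using le rest pz by simp
  then have bN: "(\<Sum>y\<in>?Z. b y) \<le> N" by (simp only: of_nat_le_iff)
  define a where "a = (\<lambda>y. if y = z then N - (\<Sum>y\<in>?Z. b y) else b y)"
  have "(\<Sum>y\<in>Y. a y) = a z + (\<Sum>y\<in>?Z. a y)" by (rule sum.remove[OF assms(1) z])
  also have "(\<Sum>y\<in>?Z. a y) = (\<Sum>y\<in>?Z. b y)" by (rule sum.cong) (auto simp: a_def)
  finally have "(\<Sum>y\<in>Y. a y) = N" using bN by (simp add: a_def)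
  moreover have "\<bar>real (a y) - p y * real N\<bar> \<le> real (card Y)" if y: "y \<in> Y" for y
  proof (cases "y = z")
    case True
    have "real (a z) = real N - (\<Sum>y\<in>?Z. real (b y))" using bN by (simp add: a_def of_nat_diff)
    then show ?thesis unfolding True using rest le ge by linarith
  next
    case False
    then have "a y = b y" by (simp add: a_def)
    then show ?thesis using b[OF y] card1 by linarith
  qed
  ultimately show ?thesis by blast
qed

text \<open>Number the disjoint union of blocks of the prescribed sizes and read off the
  block.\<close>

lemma map_with_fibre_sizes_exists:
  assumes "finite Y" "(\<Sum>y\<in>Y. a y) = N"
  shows "\<exists>\<tau>. (\<forall>i<N. \<tau> i \<in> Y) \<and> (\<forall>y\<in>Y. card {i \<in> {..<N}. \<tau> i = y} = a y)"
proof -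
  let ?S = "SIGMA y:Y. {..<a y}"
  have "card {..<N} = card ?S" using assms by (simp add: card_SigmaI)
  then obtain g where g: "bij_betw g {..<N} ?S"
    using finite_same_card_bij[of "{..<N}" ?S] assms(1) by auto
  have "fst (g i) \<in> Y" if "i < N" for i
  proof -
    have "g i \<in> ?S" using bij_betwE[OF g] that by simp
    then show ?thesis by auto
  qed
  moreover have "card {i \<in> {..<N}. fst (g i) = y} = a y" if y: "y \<in> Y" for y
  proof -
    have "bij_betw g {i \<in> {..<N}. fst (g i) = y} ({y} \<times> {..<a y})"
      unfolding bij_betw_def
    proof
      show "inj_on g {i \<in> {..<N}. fst (g i) = y}"
        using bij_betw_imp_inj_on[OF g] by (rule inj_on_subset) auto
      have gim: "g ` {..<N} = ?S" using g by (simp add: bij_betw_def)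
      show "g ` {i \<in> {..<N}. fst (g i) = y} = {y} \<times> {..<a y}"
      proof (intro equalityI subsetI)
        fix q assume "q \<in> g ` {i \<in> {..<N}. fst (g i) = y}"
        then obtain i where i: "i < N" "fst (g i) = y" "q = g i" by auto
        then have "g i \<in> ?S" unfolding gim[symmetric] by simp
        then show "q \<in> {y} \<times> {..<a y}" using i by auto
      next
        fix q assume q: "q \<in> {y} \<times> {..<a y}"
        then have "q \<in> g ` {..<N}" unfolding gim using y by auto
        then obtain i where "i < N" "q = g i" by auto
        moreover have "fst q = y" using q by auto
        ultimately show "q \<in> g ` {i \<in> {..<N}. fst (g i) = y}" by simp
      qed
    qed
    then have "card {i \<in> {..<N}. fst (g i) = y} = card ({y} \<times> {..<a y})" by (rule bij_betw_same_card)
    then show ?thesis by (simp add: card_cartesian_product)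
  qed
  ultimately show ?thesis by (intro exI[of _ "\<lambda>i. fst (g i)"]) blast
qed

text \<open>Tuples are grouped by their tuple of classes; each group is a product of fibres. This
  turns a sum over vertex tuples into one over tuples of \<open>V\<close>, weighted by class
  sizes.\<close>

lemma sum_compose_PiE:
  fixes f :: "('i \<Rightarrow> 'v) \<Rightarrow> real"
  assumes "finite S" "finite A" "finite V" "\<And>k. k \<in> A \<Longrightarrow> c k \<in> V"
  shows "(\<Sum>\<sigma>\<in>S \<rightarrow>\<^sub>E A. f (restrict (c \<circ> \<sigma>) S)) =
    (\<Sum>v\<in>S \<rightarrow>\<^sub>E V. (\<Prod>i\<in>S. real (card {k \<in> A. c k = v i})) * f v)"
proof -
  let ?g = "\<lambda>\<sigma>. restrict (c \<circ> \<sigma>) S"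
  have fibre: "{\<sigma> \<in> S \<rightarrow>\<^sub>E A. ?g \<sigma> = v} = (\<Pi>\<^sub>E i\<in>S. {k \<in> A. c k = v i})" if v: "v \<in> S \<rightarrow>\<^sub>E V" for v
  proof (intro equalityI subsetI)
    fix \<sigma> assume "\<sigma> \<in> {\<sigma> \<in> S \<rightarrow>\<^sub>E A. ?g \<sigma> = v}"
    then show "\<sigma> \<in> (\<Pi>\<^sub>E i\<in>S. {k \<in> A. c k = v i})" by (auto simp: PiE_iff)
  next
    fix \<sigma> assume \<sigma>: "\<sigma> \<in> (\<Pi>\<^sub>E i\<in>S. {k \<in> A. c k = v i})"
    have "?g \<sigma> = v"
    proof (rule extensionalityI)
      show "?g \<sigma> \<in> extensional S" by simp
      show "v \<in> extensional S" using v by (simp add: PiE_iff)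
      show "?g \<sigma> i = v i" if "i \<in> S" for i using \<sigma> that by (simp add: PiE_iff)
    qed
    then show "\<sigma> \<in> {\<sigma> \<in> S \<rightarrow>\<^sub>E A. ?g \<sigma> = v}" using \<sigma> by (auto simp: PiE_iff)
  qed
  have "(\<Sum>\<sigma>\<in>S \<rightarrow>\<^sub>E A. f (?g \<sigma>)) = (\<Sum>v\<in>S \<rightarrow>\<^sub>E V. \<Sum>\<sigma>\<in>{\<sigma> \<in> S \<rightarrow>\<^sub>E A. ?g \<sigma> = v}. f (?g \<sigma>))"
  proof (rule sum.group[symmetric])
    show "finite (S \<rightarrow>\<^sub>E A)" "finite (S \<rightarrow>\<^sub>E V)" using assms by (simp_all add: finite_PiE)
    show "?g ` (S \<rightarrow>\<^sub>E A) \<subseteq> S \<rightarrow>\<^sub>E V" using assms(4) by (auto simp: PiE_iff)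
  qed
  also have "\<dots> = (\<Sum>v\<in>S \<rightarrow>\<^sub>E V. (\<Prod>i\<in>S. real (card {k \<in> A. c k = v i})) * f v)"
  proof (rule sum.cong[OF refl])
    fix v assume v: "v \<in> S \<rightarrow>\<^sub>E V"
    have "(\<Sum>\<sigma>\<in>{\<sigma> \<in> S \<rightarrow>\<^sub>E A. ?g \<sigma> = v}. f (?g \<sigma>)) = (\<Sum>\<sigma>\<in>{\<sigma> \<in> S \<rightarrow>\<^sub>E A. ?g \<sigma> = v}. f v)"
      by (rule sum.cong) auto
    also have "\<dots> = real (card (\<Pi>\<^sub>E i\<in>S. {k \<in> A. c k = v i})) * f v" by (simp add: fibre[OF v])
    finally show "(\<Sum>\<sigma>\<in>{\<sigma> \<in> S \<rightarrow>\<^sub>E A. ?g \<sigma> = v}. f (?g \<sigma>)) = (\<Prod>i\<in>S. real (card {k \<in> A. c k = v i})) * f v"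
      by (simp add: card_PiE[OF assms(1)])
  qed
  finally show ?thesis .
qed

section \<open>The blow-up graph: its cliques and independent sets\<close>

lemma threshold_edge_iff:
  assumes "weighted_graph R" "u \<in> wverts R" "v \<in> wverts R" "u \<noteq> v"
  shows "{u, v} \<in> edges (threshold_graph R \<alpha>) \<longleftrightarrow> eweight R u v > \<alpha>"
  using assms weighted_graph.eweight_sym[OF assms(1-3)]
  by (auto simp: threshold_graph_def doubleton_eq_iff)

text \<open>\<open>\<tau>\<close> sends a vertex to its class and its point in the gadget; several
  vertices may share both. The numbering \<open>idx\<close> only fixes, for two classes, which one
  supplies the first argument of \<open>F\<close>.\<close>

locale blowup = weighted_graph R + ramsey_turan_gadget X H \<M> F \<delta> \<eta>
  for R :: "'a wgraph" and X :: "'x set" and H and \<M> :: "'m set" and F and \<delta> \<eta> :: real +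
  fixes idx :: "'a \<Rightarrow> nat" and N :: nat and \<tau> :: "nat \<Rightarrow> 'a \<times> 'x"
  assumes inj_idx: "inj_on idx (wverts R)"
    and \<tau>_range: "i < N \<Longrightarrow> \<tau> i \<in> wverts R \<times> X"
begin

abbreviation cls :: "nat \<Rightarrow> 'a" where "cls i \<equiv> fst (\<tau> i)"
abbreviation pt :: "nat \<Rightarrow> 'x" where "pt i \<equiv> snd (\<tau> i)"

lemma cls_in: "i < N \<Longrightarrow> cls i \<in> wverts R" and pt_in: "i < N \<Longrightarrow> pt i \<in> X"
  using \<tau>_range[of i] by (simp_all add: mem_Times_iff)

text \<open>Classes of weight above 1/2 are joined completely, classes of weight 0 not at all, and
  those in between by the bipartite gadget. Between two classes \<open>\<phi>\<close> is read only
  at the pair ordered by \<open>idx\<close>, which makes the relation symmetric.\<close>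

definition adj :: "('a \<times> 'a \<Rightarrow> 'm) \<Rightarrow> nat \<Rightarrow> nat \<Rightarrow> bool" where
  "adj \<phi> i j \<longleftrightarrow>
    (if cls i = cls j then H (pt i) (pt j)
     else eweight R (cls i) (cls j) > 1/2 \<or>
       eweight R (cls i) (cls j) > 0 \<and>
       (if idx (cls i) < idx (cls j) then F (\<phi> (cls i, cls j)) (pt i) (pt j)
        else F (\<phi> (cls j, cls i)) (pt j) (pt i)))"

lemma adj_sym:
  assumes "i < N" "j < N" "adj \<phi> i j"
  shows "adj \<phi> j i"
proof (cases "cls i = cls j")
  case True
  then show ?thesis using assms(3) H_sym by (simp add: adj_def)
next
  case False
  have e: "eweight R (cls j) (cls i) = eweight R (cls i) (cls j)"
    using eweight_sym cls_in assms by simp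
  have "idx (cls i) \<noteq> idx (cls j)"
    using inj_onD[OF inj_idx] cls_in assms False by blast
  then show ?thesis using assms(3) False unfolding adj_def e by (auto split: if_splits)
qed

definition G :: "('a \<times> 'a \<Rightarrow> 'm) \<Rightarrow> nat graph" where
  "G \<phi> = \<lparr>verts = {..<N}, edges = {{i, j} |i j. i < N \<and> j < N \<and> i \<noteq> j \<and> adj \<phi> i j}\<rparr>"

lemma verts_G [simp]: "verts (G \<phi>) = {..<N}"
  by (simp add: G_def)

lemma edge_G_iff: "{i, j} \<in> edges (G \<phi>) \<longleftrightarrow> i < N \<and> j < N \<and> i \<noteq> j \<and> adj \<phi> i j"
  using adj_sym by (auto simp: G_def doubleton_eq_iff)

lemma finite_simple_graph_G: "finite_simple_graph (G \<phi>)"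
  by standard (auto simp: G_def card_2_iff)

lemma clique_G_adj:
  assumes "clique (G \<phi>) S" "i \<in> S" "j \<in> S" "i \<noteq> j"
  shows "adj \<phi> i j" "i < N" "j < N"
  using assms edge_G_iff unfolding clique_def by blast+

lemma adj_same: "cls i = cls j \<Longrightarrow> adj \<phi> i j \<Longrightarrow> H (pt i) (pt j)"
  by (simp add: adj_def)

text \<open>Three vertices of a clique in one class would give a triangle of
  \<open>H\<close>.\<close>

lemma card_class_le_2:
  assumes "clique (G \<phi>) S"
  shows "card {i \<in> S. cls i = v} \<le> 2"
proof (rule ccontr)
  assume "\<not> card {i \<in> S. cls i = v} \<le> 2"
  then have "3 \<le> card {i \<in> S. cls i = v}" by simp
  then obtain T where T: "T \<subseteq> {i \<in> S. cls i = v}" "card T = 3" by (meson obtain_subset_with_card_n)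
  then obtain i j k where ijk: "T = {i, j, k}" "i \<noteq> j" "j \<noteq> k" "i \<noteq> k" by (auto simp: card_3_iff)
  have S: "i \<in> S" "j \<in> S" "k \<in> S" and c: "cls i = v" "cls j = v" "cls k = v" using T(1) ijk(1) by auto
  have "H (pt i) (pt j)" by (rule adj_same[OF _ clique_G_adj(1)[OF assms S(1,2) ijk(2)]]) (simp add: c)
  moreover have "H (pt j) (pt k)" by (rule adj_same[OF _ clique_G_adj(1)[OF assms S(2,3) ijk(3)]]) (simp add: c)
  moreover have "H (pt i) (pt k)" by (rule adj_same[OF _ clique_G_adj(1)[OF assms S(1,3) ijk(4)]]) (simp add: c)
  moreover have "pt i \<in> X" "pt j \<in> X" "pt k \<in> X"
    using pt_in clique_G_adj(2,3)[OF assms S(1,2) ijk(2)] clique_G_adj(3)[OF assms S(2,3) ijk(3)] by auto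
  ultimately show False using H_triangle_free by blast
qed

text \<open>At weight at most 1/2 all four cross pairs would have to come from \<open>F\<close>,
  which together with the two \<open>H\<close> edges is the excluded configuration.\<close>

lemma no_K4_half:
  assumes "clique (G \<phi>) S" "i \<in> S" "i' \<in> S" "j \<in> S" "j' \<in> S" "i \<noteq> i'" "j \<noteq> j'"
    and "cls i = u" "cls i' = u" "cls j = v" "cls j' = v" "idx u < idx v"
    and \<phi>: "\<phi> (u, v) \<in> \<M>"
  shows "eweight R u v > 1/2"
proof (rule ccontr)
  assume e: "\<not> eweight R u v > 1/2"
  have uv: "u \<noteq> v" using assms(12) by auto
  have F: "F (\<phi> (u, v)) (pt k) (pt l)" if "k \<in> S" "l \<in> S" "cls k = u" "cls l = v" for k l
  proof -
    have "k \<noteq> l" using that uv by auto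
    then have "adj \<phi> k l" using clique_G_adj(1)[OF assms(1)] that by simp
    then show ?thesis using e uv assms(12) by (simp add: adj_def that)
  qed
  have "H (pt i) (pt i')"
    by (rule adj_same[OF _ clique_G_adj(1)[OF assms(1,2,3,6)]]) (simp add: assms(8,9))
  moreover have "H (pt j) (pt j')"
    by (rule adj_same[OF _ clique_G_adj(1)[OF assms(1,4,5,7)]]) (simp add: assms(10,11))
  moreover have "pt i \<in> X" "pt i' \<in> X" "pt j \<in> X" "pt j' \<in> X"
    using pt_in clique_G_adj(2,3)[OF assms(1,2,3,6)] clique_G_adj(2,3)[OF assms(1,4,5,7)] by simp_all
  moreover have "F (\<phi> (u, v)) (pt i) (pt j)" "F (\<phi> (u, v)) (pt i) (pt j')"
    "F (\<phi> (u, v)) (pt i') (pt j)" "F (\<phi> (u, v)) (pt i') (pt j')"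
    using F assms(2-11) by simp_all
  ultimately show False using F_no_K4[OF \<phi>] by simp
qed

text \<open>A clique meets each class in at most two vertices, so its size is the number of classes
  met plus the number of classes met twice. These two sets of classes are the forbidden pair in
  \<open>R\<close>.\<close>

lemma clique_free_G:
  assumes "weighted_clique_free t R" "3 \<le> t" and \<phi>: "\<And>u v. u \<in> wverts R \<Longrightarrow> v \<in> wverts R \<Longrightarrow> \<phi> (u, v) \<in> \<M>"
  shows "clique_free t (G \<phi>)"
  unfolding clique_free_def
proof
  assume "\<exists>S. clique (G \<phi>) S \<and> card S = t"
  then obtain S where S: "clique (G \<phi>) S" "card S = t" by auto
  have SN: "S \<subseteq> {..<N}" using S(1) by (simp add: clique_def)
  then have fin: "finite S" by (rule finite_subset) simp
  define S1 where "S1 = cls ` S"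
  define S2 where "S2 = {v \<in> S1. card {i \<in> S. cls i = v} = 2}"
  have fin1: "finite S1" using fin by (simp add: S1_def)
  have S1V: "S1 \<subseteq> wverts R" using SN cls_in by (auto simp: S1_def)
  have S21: "S2 \<subseteq> S1" by (auto simp: S2_def)
  have R: "weighted_graph R" by unfold_locales
  have c1: "clique (threshold_graph R 0) S1"
    unfolding clique_def
  proof (intro conjI ballI impI)
    show "S1 \<subseteq> verts (threshold_graph R 0)" using S1V by (simp add: threshold_graph_def)
    fix u v assume uv: "u \<in> S1" "v \<in> S1" "u \<noteq> v"
    then obtain i j where ij: "i \<in> S" "j \<in> S" "u = cls i" "v = cls j" by (auto simp: S1_def)
    then have "i \<noteq> j" using uv(3) by auto
    from clique_G_adj(1)[OF S(1) ij(1,2) this] have "eweight R u v > 0"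
      using uv(3) by (auto simp: adj_def ij(3,4))
    then show "{u, v} \<in> edges (threshold_graph R 0)"
      using threshold_edge_iff[OF R _ _ uv(3)] S1V uv by auto
  qed
  have c2: "clique (threshold_graph R (1/2)) S2"
    unfolding clique_def
  proof (intro conjI ballI impI)
    show "S2 \<subseteq> verts (threshold_graph R (1/2))" using S21 S1V by (simp add: threshold_graph_def)
    fix u v assume uv: "u \<in> S2" "v \<in> S2" "u \<noteq> v"
    have V: "u \<in> wverts R" "v \<in> wverts R" using uv S21 S1V by auto
    obtain i i' where i: "{k \<in> S. cls k = u} = {i, i'}" "i \<noteq> i'" using uv(1) by (auto simp: S2_def card_2_iff)
    obtain j j' where j: "{k \<in> S. cls k = v} = {j, j'}" "j \<noteq> j'" using uv(2) by (auto simp: S2_def card_2_iff)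
    have iS: "i \<in> S" "i' \<in> S" "cls i = u" "cls i' = u" using i(1) by blast+
    have jS: "j \<in> S" "j' \<in> S" "cls j = v" "cls j' = v" using j(1) by blast+
    have "idx u \<noteq> idx v" using inj_onD[OF inj_idx _ V] uv(3) by blast
    then have "eweight R u v > 1/2"
    proof (rule linorder_neqE_nat)
      assume "idx u < idx v"
      then show ?thesis
        by (rule no_K4_half[OF S(1) iS(1,2) jS(1,2) i(2) j(2) iS(3,4) jS(3,4)]) (rule \<phi>[OF V])
    next
      assume "idx v < idx u"
      then have "eweight R v u > 1/2"
        by (rule no_K4_half[OF S(1) jS(1,2) iS(1,2) j(2) i(2) jS(3,4) iS(3,4)]) (rule \<phi>[OF V(2,1)])
      then show ?thesis using eweight_sym[OF V] by simp
    qed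
    then show "{u, v} \<in> edges (threshold_graph R (1/2))"
      using threshold_edge_iff[OF R V uv(3)] by simp
  qed
  have "card S = (\<Sum>i\<in>S. 1)" by simp
  also have "\<dots> = (\<Sum>v\<in>S1. \<Sum>i\<in>{i \<in> S. cls i = v}. 1)" unfolding S1_def by (rule sum.image_gen[OF fin])
  also have "\<dots> = (\<Sum>v\<in>S1. 1 + (if v \<in> S2 then 1 else 0))"
  proof (rule sum.cong[OF refl])
    fix v assume v: "v \<in> S1"
    then have "{i \<in> S. cls i = v} \<noteq> {}" by (auto simp: S1_def)
    then have "0 < card {i \<in> S. cls i = v}" using fin by (simp add: card_gt_0_iff)
    then have "card {i \<in> S. cls i = v} = (if v \<in> S2 then 2 else 1)"
      using card_class_le_2[OF S(1), of v] v by (auto simp: S2_def)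
    then show "(\<Sum>i\<in>{i \<in> S. cls i = v}. 1 :: nat) = 1 + (if v \<in> S2 then 1 else 0)"
      by simp
  qed
  also have "\<dots> = card S1 + card (S1 \<inter> S2)"
    using fin1 by (subst sum.distrib) (simp add: sum.If_cases)
  also have "S1 \<inter> S2 = S2" using S21 by auto
  finally have card: "card S1 + card S2 = t" using S(2) by simp
  show False
  proof (cases "S2 = {}")
    \<comment> \<open>The forbidden pair requires a nonempty second set. With no class met twice,
      all \<open>t\<close> vertices lie in different classes; dropping one class and taking a single
      remaining one as second set restores the total \<open>t\<close>.\<close>
    case True
    then have "card S1 = t" using card by simp
    then obtain T where T: "T \<subseteq> S1" "card T = t - 1"
      using obtain_subset_with_card_n[of "t - 1" S1] by auto
    have "T \<noteq> {}" using T assms(2) by auto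
    then obtain v where v: "v \<in> T" by auto
    have "clique (threshold_graph R 0) T" using c1 T(1) unfolding clique_def by blast
    moreover have "clique (threshold_graph R (1/2)) {v}"
      using v T(1) S1V by (auto simp: clique_def threshold_graph_def)
    moreover have "{v} \<subseteq> T" "T \<subseteq> wverts R" "card T \<ge> 1" "card {v} \<ge> 1" "card T + card {v} = t"
      using v T S1V assms(2) by auto
    ultimately show False using assms(1) unfolding weighted_clique_free_def by blast
  next
    case False
    then have "card S2 \<ge> 1" "card S1 \<ge> 1"
      using fin1 S21 finite_subset[OF S21 fin1] by (auto simp: Suc_le_eq card_gt_0_iff)
    then show False using assms(1) c1 c2 card S21 S1V unfolding weighted_clique_free_def by blast
  qed
qed

text \<open>In each class an independent set uses an \<open>H\<close>-independent set of points, at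
  most a \<open>\<delta>\<close> fraction of \<open>X\<close>, and each point carries about
  \<open>vweight R v * N / card X\<close> vertices. Summing over the classes uses that vertex
  weights add up to 1.\<close>

lemma independence_number_G_le:
  assumes "0 \<le> C" "\<And>v x. v \<in> wverts R \<Longrightarrow> x \<in> X \<Longrightarrow>
      real (card {i \<in> {..<N}. \<tau> i = (v, x)}) \<le> vweight R v * real N / real (card X) + C"
  shows "real (independence_number (G \<phi>)) \<le>
    \<delta> * real N + \<delta> * real (card X) * real (card (wverts R)) * C"
proof -
  have X0: "real (card X) > 0" using finite_X X_nonempty by (simp add: card_gt_0_iff)
  have bound: "real (card I) \<le> \<delta> * real N + \<delta> * real (card X) * real (card (wverts R)) * C"
    if I: "independent (G \<phi>) I" for I
  proof -
    define A where "A = (\<lambda>v. {x \<in> X. \<exists>i\<in>I. \<tau> i = (v, x)})"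
    let ?f = "\<lambda>v x. {i \<in> {..<N}. \<tau> i = (v, x)}"
    have IN: "I \<subseteq> {..<N}" using I by (simp add: independent_def)
    have finA: "finite (A v)" for v using finite_X by (simp add: A_def)
    have cardA: "real (card (A v)) \<le> \<delta> * real (card X)" for v
    proof (rule H_independent)
      show "A v \<subseteq> X" by (auto simp: A_def)
      fix x y assume x: "x \<in> A v" and y: "y \<in> A v"
      obtain i j where ij: "i \<in> I" "j \<in> I" "\<tau> i = (v, x)" "\<tau> j = (v, y)" using x y by (auto simp: A_def)
      show "\<not> H x y"
      proof
        assume Hxy: "H x y"
        have "x \<in> X" using x by (simp add: A_def)
        \<comment> \<open>Vertices sharing a point are harmless: \<open>H\<close> is
          irreflexive.\<close>
        then have "i \<noteq> j" using H_irrefl Hxy ij(3,4) by auto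
        moreover have "adj \<phi> i j" using ij(3,4) Hxy by (simp add: adj_def)
        ultimately have "{i, j} \<in> edges (G \<phi>)" using edge_G_iff ij(1,2) IN by auto
        then show False using I ij(1,2) by (auto simp: independent_def)
      qed
    qed
    have "I \<subseteq> (\<Union>v\<in>wverts R. \<Union>x\<in>A v. ?f v x)"
    proof
      fix i assume i: "i \<in> I"
      then have "i < N" using IN by auto
      then have "cls i \<in> wverts R" "pt i \<in> A (cls i)" using cls_in pt_in i by (auto simp: A_def)
      then show "i \<in> (\<Union>v\<in>wverts R. \<Union>x\<in>A v. ?f v x)" using \<open>i < N\<close> by fastforce
    qed
    then have "card I \<le> card (\<Union>v\<in>wverts R. \<Union>x\<in>A v. ?f v x)"
      using finite_wverts finA by (intro card_mono) auto
    also have "\<dots> \<le> (\<Sum>v\<in>wverts R. card (\<Union>x\<in>A v. ?f v x))" by (rule card_UN_le[OF finite_wverts])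
    also have "\<dots> \<le> (\<Sum>v\<in>wverts R. \<Sum>x\<in>A v. card (?f v x))" by (rule sum_mono) (rule card_UN_le[OF finA])
    finally have "real (card I) \<le> real (\<Sum>v\<in>wverts R. \<Sum>x\<in>A v. card (?f v x))" by (simp only: of_nat_le_iff)
    also have "\<dots> = (\<Sum>v\<in>wverts R. \<Sum>x\<in>A v. real (card (?f v x)))" by (simp only: of_nat_sum)
    also have "\<dots> \<le> (\<Sum>v\<in>wverts R. \<delta> * real (card X) * (vweight R v * real N / real (card X) + C))"
    proof (rule sum_mono)
      fix v assume v: "v \<in> wverts R"
      have nn: "0 \<le> vweight R v * real N / real (card X) + C"
        using vweight_range[OF v] X0 assms(1) by (auto intro!: add_nonneg_nonneg divide_nonneg_nonneg mult_nonneg_nonneg)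
      have "(\<Sum>x\<in>A v. real (card (?f v x))) \<le> (\<Sum>x\<in>A v. vweight R v * real N / real (card X) + C)"
        by (rule sum_mono) (rule assms(2)[OF v], simp add: A_def)
      also have "\<dots> = real (card (A v)) * (vweight R v * real N / real (card X) + C)" by simp
      also have "\<dots> \<le> \<delta> * real (card X) * (vweight R v * real N / real (card X) + C)"
        by (rule mult_right_mono[OF cardA nn])
      finally show "(\<Sum>x\<in>A v. real (card (?f v x))) \<le> \<delta> * real (card X) * (vweight R v * real N / real (card X) + C)" .
    qed
    also have "\<dots> = (\<Sum>v\<in>wverts R. \<delta> * real N * vweight R v + \<delta> * real (card X) * C)"
      using X0 by (intro sum.cong refl) (simp add: field_simps)
    also have "\<dots> = \<delta> * real N * (\<Sum>v\<in>wverts R. vweight R v) + real (card (wverts R)) * (\<delta> * real (card X) * C)"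
      by (simp add: sum.distrib sum_distrib_left)
    also have "\<dots> = \<delta> * real N + \<delta> * real (card X) * real (card (wverts R)) * C"
      by (simp add: vweight_sum)
    finally show ?thesis .
  qed
  let ?Z = "{card S |S. independent (G \<phi>) S}"
  \<comment> \<open>The set of sizes is finite and contains that of the empty set, so
    \<open>Max\<close> is attained by some independent set.\<close>
  have "?Z \<subseteq> card ` Pow {..<N}" by (auto simp: independent_def)
  then have "finite ?Z" by (rule finite_subset) simp
  moreover have "independent (G \<phi>) {}" by (simp add: independent_def)
  then have "?Z \<noteq> {}" by blast
  ultimately have "Max ?Z \<in> ?Z" by (rule Max_in)
  then obtain I where "independent (G \<phi>) I" "independence_number (G \<phi>) = card I"
    unfolding independence_number_def by blast
  then show ?thesis using bound by simp
qed

section \<open>Averaging the number of cliques over the matrices\<close>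

definition pairs :: "nat \<Rightarrow> (nat \<times> nat) set" where
  "pairs s = {(i, j). 1 \<le> i \<and> i < j \<and> j \<le> s}"

lemma finite_pairs: "finite (pairs s)"
  by (rule finite_subset[of _ "{1..s} \<times> {1..s}"]) (auto simp: pairs_def)

lemma card_pairs_le: "card (pairs s) \<le> s\<^sup>2"
proof -
  have "card (pairs s) \<le> card ({1..s} \<times> {1..s})" by (rule card_mono) (auto simp: pairs_def)
  then show ?thesis by (simp add: card_cartesian_product power2_eq_square)
qed

text \<open>Counting in this product set plays the role of independent uniform matrices, one for
  each ordered pair of classes.\<close>

definition choices :: "('a \<times> 'a \<Rightarrow> 'm) set" where
  "choices = (wverts R \<times> wverts R) \<rightarrow>\<^sub>E \<M>"

lemma finite_choices: "finite choices"
  unfolding choices_def using finite_wverts finite_M by (intro finite_PiE) auto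

lemma card_choices: "card choices = card \<M> ^ card (wverts R \<times> wverts R)"
  unfolding choices_def using finite_wverts by (simp add: card_PiE)

text \<open>Vertex weights are left out here: they enter through the class sizes.\<close>

definition tuple_weight :: "nat \<Rightarrow> (nat \<Rightarrow> 'a) \<Rightarrow> real" where
  "tuple_weight s v = (\<Prod>(i, j)\<in>pairs s. eweight R (v i) (v j))"

text \<open>A tuple is a clique as soon as its half-weight pairs are joined, and each of these is governed by
  a different coordinate of \<open>\<phi>\<close>; so their probabilities multiply.\<close>

lemma card_choices_clique_ge:
  assumes \<eta>: "0 \<le> \<eta>" "\<eta> \<le> 1/2" and \<sigma>: "\<sigma> \<in> {1..s} \<rightarrow>\<^sub>E {..<N}"
  shows "real (card choices) * (1 - 2 * \<eta> * (real s)\<^sup>2) * tuple_weight s (\<lambda>i. cls (\<sigma> i)) \<le>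
    real (card {\<phi> \<in> choices. inj_on \<sigma> {1..s} \<and> clique (G \<phi>) (\<sigma> ` {1..s})})"
proof (cases "tuple_weight s (\<lambda>i. cls (\<sigma> i)) = 0")
  case False
  let ?c = "\<lambda>i. cls (\<sigma> i)" and ?S = "{1..s}"
  have \<sigma>N: "\<sigma> i < N" if "i \<in> ?S" for i using \<sigma> that by (auto simp: PiE_iff)
  have cV: "?c i \<in> wverts R" if "i \<in> ?S" for i using cls_in[OF \<sigma>N[OF that]] .
  have ptX: "pt (\<sigma> i) \<in> X" if "i \<in> ?S" for i using pt_in[OF \<sigma>N[OF that]] .
  have nz: "eweight R (?c i) (?c j) \<noteq> 0" if "i \<in> ?S" "j \<in> ?S" "i < j" for i j
  proof -
    have "(i, j) \<in> pairs s" using that by (simp add: pairs_def)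
    then show ?thesis using False finite_pairs by (auto simp: tuple_weight_def prod_zero_iff)
  qed
  have pos: "eweight R (?c i) (?c j) > 0" if "i \<in> ?S" "j \<in> ?S" "i < j" for i j
    using nz[OF that] eweight_range[OF cV[OF that(1)] cV[OF that(2)]] by simp
  \<comment> \<open>Diagonal weights are 0, so a tuple of nonzero weight visits distinct
    classes.\<close>
  have inj: "inj_on ?c ?S"
  proof (rule linorder_inj_onI)
    fix i j assume ij: "i < j" "i \<in> ?S" "j \<in> ?S"
    show "?c i \<noteq> ?c j"
    proof
      assume "?c i = ?c j"
      then have "eweight R (?c i) (?c j) = 0" using eweight_diag[OF cV[OF ij(3)]] by simp
      then show False using nz[OF ij(2,3,1)] by simp
    qed
  qed auto
  have inj\<sigma>: "inj_on \<sigma> ?S"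
  proof (rule inj_onI)
    fix i j assume ij: "i \<in> ?S" "j \<in> ?S" "\<sigma> i = \<sigma> j"
    then have "?c i = ?c j" by simp
    then show "i = j" by (rule inj_onD[OF inj _ ij(1,2)])
  qed
  \<comment> \<open>The point at which the tuple sits in class \<open>a\<close>; well defined since
    the classes are distinct.\<close>
  define x where "x = (\<lambda>a. pt (\<sigma> (inv_into ?S ?c a)))"
  have x: "x (?c i) = pt (\<sigma> i)" if "i \<in> ?S" for i
    using inv_into_f_f[OF inj that] by (simp add: x_def)
  define P where "P = {(i, j) \<in> pairs s. eweight R (?c i) (?c j) \<le> 1/2}"
  \<comment> \<open>The coordinate of \<open>\<phi>\<close> that \<open>adj\<close> consults for
    this pair of positions.\<close>
  define ord where "ord = (\<lambda>(i, j). if idx (?c i) < idx (?c j) then (?c i, ?c j) else (?c j, ?c i))"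
  define Q where "Q = ord ` P"
  have P_pairs: "P \<subseteq> pairs s" by (auto simp: P_def)
  then have finP: "finite P" using finite_pairs by (rule finite_subset)
  have P_S: "i \<in> ?S" "j \<in> ?S" "i < j" if "(i, j) \<in> P" for i j
    using that by (auto simp: P_def pairs_def)
  have Q_S: "\<exists>i\<in>?S. \<exists>j\<in>?S. q = (?c i, ?c j)" if q: "q \<in> Q" for q
  proof -
    obtain i j where ij: "(i, j) \<in> P" "q = ord (i, j)" using q by (auto simp: Q_def)
    then show ?thesis using P_S[OF ij(1)] unfolding ord_def by (cases "idx (?c i) < idx (?c j)") auto
  qed
  have QV: "Q \<subseteq> wverts R \<times> wverts R"
  proof
    fix q assume "q \<in> Q"
    then obtain i j where "i \<in> ?S" "j \<in> ?S" "q = (?c i, ?c j)" using Q_S by blast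
    then show "q \<in> wverts R \<times> wverts R" using cV by simp
  qed
  \<comment> \<open>One constraint per coordinate: the choices satisfying all of them form a product
    set, whose size is a product.\<close>
  define C where "C = (\<lambda>q. if q \<in> Q then {M \<in> \<M>. F M (x (fst q)) (x (snd q))} else \<M>)"
  have good: "clique (G \<phi>) (\<sigma> ` ?S)" if \<phi>: "\<phi> \<in> (wverts R \<times> wverts R) \<rightarrow>\<^sub>E \<M>" "\<And>q. q \<in> Q \<Longrightarrow> \<phi> q \<in> C q" for \<phi>
  proof -
    have A: "adj \<phi> (\<sigma> i) (\<sigma> j)" if ij: "i \<in> ?S" "j \<in> ?S" "i < j" for i j
    proof (cases "eweight R (?c i) (?c j) > 1/2")
      case True
      then show ?thesis using inj_onD[OF inj _ ij(1,2)] ij(3) by (auto simp: adj_def)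
    next
      case F: False
      then have P: "(i, j) \<in> P" using ij by (auto simp: P_def pairs_def)
      have ne: "?c i \<noteq> ?c j" using inj_onD[OF inj _ ij(1,2)] ij(3) by auto
      have "\<phi> (ord (i, j)) \<in> C (ord (i, j))" by (rule \<phi>(2)) (use P in \<open>simp add: Q_def\<close>)
      moreover have "ord (i, j) \<in> Q" using P by (simp add: Q_def)
      ultimately have "F (\<phi> (ord (i, j))) (x (fst (ord (i, j)))) (x (snd (ord (i, j))))" by (simp add: C_def)
      then show ?thesis using pos[OF ij] ne x[OF ij(1)] x[OF ij(2)]
        by (auto simp: adj_def ord_def split: if_splits)
    qed
    show ?thesis
      unfolding clique_def
    proof (intro conjI ballI impI)
      show "\<sigma> ` ?S \<subseteq> verts (G \<phi>)" using \<sigma>N by auto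
      fix k l assume kl: "k \<in> \<sigma> ` ?S" "l \<in> \<sigma> ` ?S" "k \<noteq> l"
      then obtain i j where ij: "i \<in> ?S" "j \<in> ?S" "k = \<sigma> i" "l = \<sigma> j" by blast
      have "i \<noteq> j" using kl(3) ij by auto
      then have "adj \<phi> k l"
      proof (rule linorder_neqE_nat)
        assume "i < j"
        then show ?thesis using A[OF ij(1,2)] ij by simp
      next
        assume "j < i"
        then show ?thesis using adj_sym[OF \<sigma>N \<sigma>N A] ij by simp
      qed
      then show "{k, l} \<in> edges (G \<phi>)" using edge_G_iff \<sigma>N ij kl(3) by simp
    qed
  qed
  let ?W = "wverts R \<times> wverts R" and ?m = "real (card \<M>)"
  have finW: "finite ?W" using finite_wverts by simp
  have m0: "0 \<le> (1/2 - \<eta>) * ?m" using \<eta> by simp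
  have "(1/2 - \<eta>) ^ card Q * ?m ^ card ?W = (\<Prod>q\<in>?W. if q \<in> Q then (1/2 - \<eta>) else 1) * (\<Prod>q\<in>?W. ?m)"
  proof -
    have "?W \<inter> {q. q \<in> Q} = Q" using QV by blast
    then show ?thesis using finW by (simp add: prod.If_cases del: card_cartesian_product)
  qed
  also have "\<dots> = (\<Prod>q\<in>?W. (if q \<in> Q then (1/2 - \<eta>) else 1) * ?m)" by (rule prod.distrib[symmetric])
  also have "\<dots> \<le> (\<Prod>q\<in>?W. real (card (C q)))"
  proof (rule prod_mono, intro conjI)
    fix q assume "q \<in> ?W"
    show "0 \<le> (if q \<in> Q then (1/2 - \<eta>) else 1) * ?m" using m0 by simp
    show "(if q \<in> Q then (1/2 - \<eta>) else 1) * ?m \<le> real (card (C q))"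
    proof (cases "q \<in> Q")
      case True
      obtain i j where "i \<in> ?S" "j \<in> ?S" "q = (?c i, ?c j)" using Q_S[OF True] by blast
      then have "x (fst q) \<in> X" "x (snd q) \<in> X" using x ptX by simp_all
      then show ?thesis using F_dense True by (simp add: C_def)
    qed (simp add: C_def)
  qed
  also have "\<dots> = real (card (PiE ?W C))" using finW by (simp add: card_PiE)
  also have "\<dots> \<le> real (card {\<phi> \<in> choices. inj_on \<sigma> ?S \<and> clique (G \<phi>) (\<sigma> ` ?S)})"
  proof -
    have "PiE ?W C \<subseteq> {\<phi> \<in> choices. inj_on \<sigma> ?S \<and> clique (G \<phi>) (\<sigma> ` ?S)}"
    proof
      fix \<phi> assume \<phi>: "\<phi> \<in> PiE ?W C"
      have "C q \<subseteq> \<M>" for q by (auto simp: C_def)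
      then have \<phi>M: "\<phi> \<in> ?W \<rightarrow>\<^sub>E \<M>" using \<phi> PiE_mono[of ?W C "\<lambda>_. \<M>"] by blast
      have "clique (G \<phi>) (\<sigma> ` ?S)"
      proof (rule good[OF \<phi>M])
        fix q assume "q \<in> Q"
        then have "q \<in> ?W" by (rule subsetD[OF QV])
        then show "\<phi> q \<in> C q" by (rule PiE_mem[OF \<phi>])
      qed
      then show "\<phi> \<in> {\<phi> \<in> choices. inj_on \<sigma> ?S \<and> clique (G \<phi>) (\<sigma> ` ?S)}"
        using \<phi>M inj\<sigma> by (simp add: choices_def)
    qed
    then show ?thesis using finite_choices by (simp add: card_mono)
  qed
  finally have main: "(1/2 - \<eta>) ^ card Q * ?m ^ card ?W \<le>
      real (card {\<phi> \<in> choices. inj_on \<sigma> ?S \<and> clique (G \<phi>) (\<sigma> ` ?S)})" .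
  \<comment> \<open>The base \<open>1/2 - \<eta>\<close> lies between 0 and 1, so the power with
    exponent \<open>card P\<close> bounds the one with \<open>card Q\<close> from below.\<close>
  have cardQ: "card Q \<le> card P" unfolding Q_def by (rule card_image_le[OF finP])
  have cardP: "card P \<le> s\<^sup>2"
    using card_mono[OF finite_pairs P_pairs] card_pairs_le[of s] by linarith
  let ?t = "tuple_weight s ?c"
  have t: "0 \<le> ?t" "?t \<le> (1/2) ^ card P"
  proof -
    have e: "0 \<le> eweight R (?c i) (?c j) \<and> eweight R (?c i) (?c j) \<le> (if (i, j) \<in> P then 1/2 else 1)"
      if "(i, j) \<in> pairs s" for i j
    proof -
      have "?c i \<in> wverts R" "?c j \<in> wverts R" using that by (auto simp: pairs_def intro!: cV)
      then show ?thesis using eweight_range[of "?c i" "?c j"] by (auto simp: P_def)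
    qed
    show "0 \<le> ?t" unfolding tuple_weight_def by (rule prod_nonneg) (use e in auto)
    \<comment> \<open>Each pair in \<open>P\<close> contributes a weight of at most 1/2, matching
      the joining probability; the other weights are at most 1.\<close>
    have "?t \<le> (\<Prod>p\<in>pairs s. if p \<in> P then 1/2 else 1)"
      unfolding tuple_weight_def
    proof (rule prod_mono)
      fix p assume "p \<in> pairs s"
      then show "0 \<le> (case p of (i, j) \<Rightarrow> eweight R (?c i) (?c j)) \<and>
          (case p of (i, j) \<Rightarrow> eweight R (?c i) (?c j)) \<le> (if p \<in> P then 1/2 else 1)"
        using e[of "fst p" "snd p"] by (simp only: prod.collapse case_prod_beta)
    qed
    also have "\<dots> = (1/2) ^ card P"
    proof -
      have "pairs s \<inter> {p. p \<in> P} = P" using P_pairs by blast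
      then show ?thesis using finite_pairs by (simp add: prod.If_cases)
    qed
    finally show "?t \<le> (1/2) ^ card P" .
  qed
  have "(1 - 2 * \<eta> * (real s)\<^sup>2) * ?t \<le> (1/2 - \<eta>) ^ card Q"
  proof -
    have "real (card P) \<le> real (s\<^sup>2)" using cardP by (simp only: of_nat_le_iff)
    then have "2 * \<eta> * real (card P) \<le> 2 * \<eta> * (real s)\<^sup>2" using \<eta>(1) by (intro mult_left_mono) auto
    then have "1 - 2 * \<eta> * (real s)\<^sup>2 \<le> 1 + real (card P) * (- (2 * \<eta>))" by (simp add: mult_ac)
    \<comment> \<open>Each factor \<open>1/2 - \<eta>\<close> is \<open>1 - 2 * \<eta>\<close> times
      1/2; Bernoulli makes the accumulated loss linear in the number of pairs.\<close>
    also have "\<dots> \<le> (1 + (- (2 * \<eta>))) ^ card P"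
      by (rule Bernoulli_inequality) (use \<eta> in simp)
    finally have "1 - 2 * \<eta> * (real s)\<^sup>2 \<le> (1 - 2 * \<eta>) ^ card P" by simp
    then have "(1 - 2 * \<eta> * (real s)\<^sup>2) * ?t \<le> (1 - 2 * \<eta>) ^ card P * ?t" using t(1) by (rule mult_right_mono)
    also have "\<dots> \<le> (1 - 2 * \<eta>) ^ card P * (1/2) ^ card P"
      using t(2) \<eta> by (intro mult_left_mono) auto
    also have "\<dots> = (1/2 - \<eta>) ^ card P"
      by (simp add: power_mult_distrib[symmetric] algebra_simps)
    also have "\<dots> \<le> (1/2 - \<eta>) ^ card Q"
      using \<eta> cardQ by (intro power_decreasing) auto
    finally show ?thesis .
  qed
  then have "?m ^ card ?W * ((1 - 2 * \<eta> * (real s)\<^sup>2) * ?t) \<le> ?m ^ card ?W * (1/2 - \<eta>) ^ card Q"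
    by (intro mult_left_mono) auto
  also have "\<dots> = (1/2 - \<eta>) ^ card Q * ?m ^ card ?W" by (rule mult.commute)
  also note main
  finally show ?thesis by (simp only: card_choices of_nat_power mult.assoc)
qed simp

text \<open>Double counting of pairs of a choice and a tuple: some choice does at least as well as
  the average. The tuples are then grouped by class.\<close>

lemma ex_choice_density:
  assumes \<eta>: "0 \<le> \<eta>" "\<eta> \<le> 1/2"
  shows "\<exists>\<phi>\<in>choices. (1 - 2 * \<eta> * (real s)\<^sup>2) *
    (\<Sum>v\<in>{1..s} \<rightarrow>\<^sub>E wverts R. (\<Prod>i\<in>{1..s}. real (card {k \<in> {..<N}. cls k = v i}) / real N) * tuple_weight s v)
    \<le> clique_density s (G \<phi>)"
proof -
  let ?A = "{1..s} \<rightarrow>\<^sub>E {..<N}" and ?c = "1 - 2 * \<eta> * (real s)\<^sup>2"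
  let ?g = "\<lambda>\<phi> \<sigma>. inj_on \<sigma> {1..s} \<and> clique (G \<phi>) (\<sigma> ` {1..s})"
  let ?T = "\<Sum>\<sigma>\<in>?A. tuple_weight s (\<lambda>i. cls (\<sigma> i))"
  have finA: "finite ?A" by (simp add: finite_PiE)
  have ne: "choices \<noteq> {}" unfolding choices_def using M_nonempty by (simp add: PiE_eq_empty_iff)
  have "real (card choices) * ?c * ?T = (\<Sum>\<sigma>\<in>?A. real (card choices) * ?c * tuple_weight s (\<lambda>i. cls (\<sigma> i)))"
    by (rule sum_distrib_left)
  also have "\<dots> \<le> (\<Sum>\<sigma>\<in>?A. real (card {\<phi> \<in> choices. ?g \<phi> \<sigma>}))"
    by (rule sum_mono) (rule card_choices_clique_ge[OF \<eta>])
  also have "\<dots> = (\<Sum>\<sigma>\<in>?A. \<Sum>\<phi>\<in>choices. if ?g \<phi> \<sigma> then 1 else 0)"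
    using finite_choices by (simp add: sum.If_cases Int_def)
  also have "\<dots> = (\<Sum>\<phi>\<in>choices. \<Sum>\<sigma>\<in>?A. if ?g \<phi> \<sigma> then 1 else 0)" by (rule sum.swap)
  also have "\<dots> = (\<Sum>\<phi>\<in>choices. real (card {\<sigma> \<in> ?A. ?g \<phi> \<sigma>}))"
    using finA by (simp add: sum.If_cases Int_def)
  finally have avg: "(\<Sum>\<phi>\<in>choices. ?c * ?T) \<le> (\<Sum>\<phi>\<in>choices. real (card {\<sigma> \<in> ?A. ?g \<phi> \<sigma>}))" by simp
  have "\<exists>\<phi>\<in>choices. ?c * ?T \<le> real (card {\<sigma> \<in> ?A. ?g \<phi> \<sigma>})"
  proof (rule ccontr)
    assume "\<not> ?thesis"
    then have "(\<Sum>\<phi>\<in>choices. real (card {\<sigma> \<in> ?A. ?g \<phi> \<sigma>})) < (\<Sum>\<phi>\<in>choices. ?c * ?T)"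
      by (intro sum_strict_mono[OF finite_choices ne]) (auto simp: not_le)
    then show False using avg by linarith
  qed
  then obtain \<phi> where \<phi>: "\<phi> \<in> choices" "?c * ?T \<le> real (card {\<sigma> \<in> ?A. ?g \<phi> \<sigma>})" by blast
  \<comment> \<open>The weight sees only the classes at positions in \<open>{1..s}\<close>, so the
    class tuple may be made extensional for the grouping.\<close>
  have "?T = (\<Sum>\<sigma>\<in>?A. tuple_weight s (restrict (cls \<circ> \<sigma>) {1..s}))"
    unfolding tuple_weight_def by (intro sum.cong prod.cong refl) (auto simp: pairs_def)
  also have "\<dots> = (\<Sum>v\<in>{1..s} \<rightarrow>\<^sub>E wverts R. (\<Prod>i\<in>{1..s}. real (card {k \<in> {..<N}. cls k = v i})) * tuple_weight s v)"
    by (rule sum_compose_PiE) (use finite_wverts cls_in in auto)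
  finally have T: "?T / real N ^ s = (\<Sum>v\<in>{1..s} \<rightarrow>\<^sub>E wverts R.
      (\<Prod>i\<in>{1..s}. real (card {k \<in> {..<N}. cls k = v i}) / real N) * tuple_weight s v)"
    by (simp add: sum_divide_distrib prod_dividef)
  have "?c * (?T / real N ^ s) \<le> clique_density s (G \<phi>)"
    using divide_right_mono[OF \<phi>(2), of "real N ^ s"] by (simp add: clique_density_def)
  then show ?thesis using \<phi>(1) unfolding T by blast
qed

end

section \<open>Letting the number of vertices grow\<close>

lemma weighted_clique_density_nonneg:
  assumes "weighted_graph R"
  shows "0 \<le> weighted_clique_density s R"
proof -
  interpret weighted_graph R by fact
  show ?thesis
    unfolding weighted_clique_density_def
  proof (intro sum_nonneg mult_nonneg_nonneg prod_nonneg)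
    fix v i assume "v \<in> {1..s} \<rightarrow>\<^sub>E wverts R" "i \<in> {1..s}"
    then have "v i \<in> wverts R" by (rule PiE_mem)
    then show "0 \<le> vweight R (v i)" using vweight_range by simp
  next
    fix v p assume v: "v \<in> {1..s} \<rightarrow>\<^sub>E wverts R" and "p \<in> {(i, j). 1 \<le> i \<and> i < j \<and> j \<le> s}"
    then obtain i j where p: "p = (i, j)" "i \<in> {1..s}" "j \<in> {1..s}" by auto
    then show "0 \<le> (case p of (i, j) \<Rightarrow> eweight R (v i) (v j))"
      using eweight_range[OF PiE_mem[OF v p(2)] PiE_mem[OF v p(3)]] by simp
  qed
qed

text \<open>The gadget is fixed once and for all, so the errors from rounding class sizes are
  bounded independently of \<open>N\<close>. They cost a further \<open>\<theta> * N\<close> in the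
  independence number and vanish in the limit of the densities.\<close>

lemma ramsey_turan_blowup:
  fixes R :: "'a wgraph"
  assumes R: "weighted_graph R" "weighted_clique_free t R" and t: "3 \<le> t"
    and \<theta>: "0 < \<theta>" and \<kappa>: "0 < \<kappa>"
  shows "\<forall>\<^sub>F N in sequentially. \<exists>G :: nat graph.
    finite_simple_graph G \<and> card (verts G) = N \<and> clique_free t G \<and>
    real (independence_number G) \<le> 2 * \<theta> * real N \<and>
    (1 - \<kappa>) * weighted_clique_density s R \<le> clique_density s G"
proof -
  interpret R: weighted_graph R by (rule R(1))
  \<comment> \<open>The denominator makes \<open>2 * \<eta> * (real s)\<^sup>2\<close> strictly
    smaller than \<open>\<kappa>\<close>, leaving a gap for the rounding error; the cap 1/4 keeps
    \<open>\<eta>\<close> below 1/2.\<close>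
  define \<eta> where "\<eta> = min (1/4) (\<kappa> / (4 * (real s)\<^sup>2 + 1))"
  have den: "0 < 4 * (real s)\<^sup>2 + 1" by (rule add_nonneg_pos) auto
  have \<eta>: "0 < \<eta>" "\<eta> < 1/2" "2 * \<eta> * (real s)\<^sup>2 < \<kappa>"
  proof -
    show "0 < \<eta>" using \<kappa> den by (simp add: \<eta>_def)
    have "\<eta> \<le> 1/4" unfolding \<eta>_def by (rule min.cobounded1)
    then show "\<eta> < 1/2" by simp
    have "\<eta> \<le> \<kappa> / (4 * (real s)\<^sup>2 + 1)" unfolding \<eta>_def by (rule min.cobounded2)
    then have "\<eta> * (4 * (real s)\<^sup>2 + 1) \<le> \<kappa>" using den by (simp add: pos_le_divide_eq)
    then have "2 * (2 * \<eta> * (real s)\<^sup>2) + \<eta> \<le> \<kappa>" by (simp add: algebra_simps)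
    moreover have "0 \<le> 2 * \<eta> * (real s)\<^sup>2" using \<open>0 < \<eta>\<close> by simp
    ultimately show "2 * \<eta> * (real s)\<^sup>2 < \<kappa>" using \<open>0 < \<eta>\<close> by linarith
  qed
  obtain X :: "(nat \<Rightarrow> real) set" and H \<M> and F :: "(nat \<times> nat \<Rightarrow> real) \<Rightarrow> (nat \<Rightarrow> real) \<Rightarrow> (nat \<Rightarrow> real) \<Rightarrow> bool"
    where gad: "ramsey_turan_gadget X H \<M> F \<theta> \<eta>"
    using ramsey_turan_gadget_exists[OF \<theta> \<eta>(1,2)] by blast
  interpret gad: ramsey_turan_gadget X H \<M> F \<theta> \<eta> by (rule gad)
  let ?V = "wverts R" and ?Y = "wverts R \<times> X"
  let ?C = "real (card ?Y)"
  have V0: "?V \<noteq> {}" using R.vweight_sum by auto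
  have X0: "real (card X) > 0" using gad.finite_X gad.X_nonempty by (simp add: card_gt_0_iff)
  obtain idx :: "'a \<Rightarrow> nat" where idx: "inj_on idx ?V"
    using finite_imp_inj_to_nat_seg[OF R.finite_wverts] by blast
  define p where "p = (\<lambda>y :: 'a \<times> (nat \<Rightarrow> real). vweight R (fst y) / real (card X))"
  have sizes: "\<exists>a. (\<Sum>y\<in>?Y. a y) = N \<and> (\<forall>y\<in>?Y. \<bar>real (a y) - p y * real N\<bar> \<le> ?C)" for N
  proof (rule rounded_sizes_exist)
    show "finite ?Y" using R.finite_wverts gad.finite_X by simp
    show "?Y \<noteq> {}" using V0 gad.X_nonempty by simp
    show "0 \<le> p y" if "y \<in> ?Y" for y using R.vweight_range that by (auto simp: p_def)
    have "(\<Sum>y\<in>?Y. p y) = (\<Sum>v\<in>?V. \<Sum>x\<in>X. vweight R v / real (card X))"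
      unfolding p_def sum.cartesian_product by (simp only: case_prod_unfold)
    also have "\<dots> = 1" using X0 R.vweight_sum by simp
    finally show "(\<Sum>y\<in>?Y. p y) = 1" .
  qed
  define balanced where "balanced = (\<lambda>N \<tau>. (\<forall>i<N. \<tau> i \<in> ?Y) \<and>
      (\<forall>y\<in>?Y. \<bar>real (card {i \<in> {..<N}. \<tau> i = y}) - p y * real N\<bar> \<le> ?C))"
  have balanced_ex: "\<exists>\<tau>. balanced N \<tau>" for N
  proof -
    obtain a where a: "(\<Sum>y\<in>?Y. a y) = N" "\<And>y. y \<in> ?Y \<Longrightarrow> \<bar>real (a y) - p y * real N\<bar> \<le> ?C"
      using sizes[of N] by blast
    obtain \<tau> where \<tau>: "\<forall>i<N. \<tau> i \<in> ?Y" "\<forall>y\<in>?Y. card {i \<in> {..<N}. \<tau> i = y} = a y"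
      using map_with_fibre_sizes_exists[OF finite_cartesian_product[OF R.finite_wverts gad.finite_X] a(1)] by blast
    then have "balanced N \<tau>" using a(2) by (simp add: balanced_def)
    then show ?thesis by (rule exI[of _ \<tau>])
  qed
  \<comment> \<open>One fixed choice for each \<open>N\<close>, so that class sizes become sequences
    whose limits can be taken.\<close>
  define \<tau> where "\<tau> = (\<lambda>N. SOME \<tau>. balanced N \<tau>)"
  have "balanced N (\<tau> N)" for N unfolding \<tau>_def by (rule someI_ex[OF balanced_ex])
  then have \<tau>: "\<And>N i. i < N \<Longrightarrow> \<tau> N i \<in> ?Y"
    "\<And>N y. y \<in> ?Y \<Longrightarrow> \<bar>real (card {i \<in> {..<N}. \<tau> N i = y}) - p y * real N\<bar> \<le> ?C"
    unfolding balanced_def by blast+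
  have blow: "blowup R X H \<M> F \<theta> \<eta> idx N (\<tau> N)" for N
    by unfold_locales (use idx \<tau>(1) in auto)
  define n where "n = (\<lambda>N v. real (card {k \<in> {..<N}. fst (\<tau> N k) = v}))"
  \<comment> \<open>A class is the union of \<open>card X\<close> fibres, each off by at most
    \<open>card ?Y\<close>.\<close>
  have n_bound: "\<bar>n N v - vweight R v * real N\<bar> \<le> real (card X) * ?C" if v: "v \<in> ?V" for N v
  proof -
    have "{k \<in> {..<N}. fst (\<tau> N k) = v} = (\<Union>x\<in>X. {k \<in> {..<N}. \<tau> N k = (v, x)})"
    proof (intro equalityI subsetI)
      fix k assume k: "k \<in> {k \<in> {..<N}. fst (\<tau> N k) = v}"
      then have "\<tau> N k \<in> ?Y" using \<tau>(1) by simp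
      then have "snd (\<tau> N k) \<in> X" "\<tau> N k = (v, snd (\<tau> N k))" using k by (auto simp: prod_eq_iff)
      then show "k \<in> (\<Union>x\<in>X. {k \<in> {..<N}. \<tau> N k = (v, x)})" using k by blast
    qed auto
    moreover have "card (\<Union>x\<in>X. {k \<in> {..<N}. \<tau> N k = (v, x)}) = (\<Sum>x\<in>X. card {k \<in> {..<N}. \<tau> N k = (v, x)})"
      by (rule card_UN_disjoint) (use gad.finite_X in auto)
    ultimately have "n N v = (\<Sum>x\<in>X. real (card {k \<in> {..<N}. \<tau> N k = (v, x)}))"
      unfolding n_def by (simp only: of_nat_sum)
    moreover have "vweight R v * real N = (\<Sum>x\<in>X. p (v, x) * real N)" using X0 by (simp add: p_def)
    ultimately have "n N v - vweight R v * real N = (\<Sum>x\<in>X. real (card {k \<in> {..<N}. \<tau> N k = (v, x)}) - p (v, x) * real N)"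
      by (simp only: sum_subtractf)
    also have "\<bar>\<dots>\<bar> \<le> (\<Sum>x\<in>X. \<bar>real (card {k \<in> {..<N}. \<tau> N k = (v, x)}) - p (v, x) * real N\<bar>)"
      by (rule sum_abs)
    also have "\<dots> \<le> (\<Sum>x\<in>X. ?C)" by (rule sum_mono) (rule \<tau>(2), use v in simp)
    finally show ?thesis by simp
  qed
  have lim: "(\<lambda>N. n N v / real N) \<longlonglongrightarrow> vweight R v" if v: "v \<in> ?V" for v
  proof (rule LIM_zero_cancel, rule tendsto_0_le)
    show "(\<lambda>N. real (card X) * ?C / real N) \<longlonglongrightarrow> 0" by (rule lim_const_over_n)
    show "\<forall>\<^sub>F N in sequentially. norm (n N v / real N - vweight R v) \<le> norm (real (card X) * ?C / real N) * 1"
      using eventually_gt_at_top[of 0]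
    proof eventually_elim
      case (elim N)
      then have "n N v / real N - vweight R v = (n N v - vweight R v * real N) / real N" by (simp add: field_simps)
      also have "norm \<dots> = \<bar>n N v - vweight R v * real N\<bar> / real N" by simp
      also have "\<dots> \<le> real (card X) * ?C / real N" by (rule divide_right_mono[OF n_bound[OF v]]) simp
      finally show ?case by simp
    qed
  qed
  define w where "w = (\<lambda>v. \<Prod>(i, j)\<in>{(i, j). 1 \<le> i \<and> i < j \<and> j \<le> s}. eweight R (v i) (v j))"
  define D where "D = (\<lambda>N. \<Sum>v\<in>{1..s} \<rightarrow>\<^sub>E ?V. (\<Prod>i\<in>{1..s}. n N (v i) / real N) * w v)"
  have D: "D \<longlonglongrightarrow> weighted_clique_density s R"
    unfolding D_def weighted_clique_density_def w_def
    by (intro tendsto_sum tendsto_mult tendsto_prod tendsto_const lim) (auto simp: PiE_iff)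
  \<comment> \<open>The limit argument needs a strict gap, which exists only for positive density.
    At density 0 the target bound is 0 and nonnegativity suffices.\<close>
  have dens: "\<forall>\<^sub>F N in sequentially. (1 - \<kappa>) * weighted_clique_density s R \<le> (1 - 2 * \<eta> * (real s)\<^sup>2) * D N \<or>
      weighted_clique_density s R = 0"
  proof (cases "weighted_clique_density s R = 0")
    case False
    then have "0 < weighted_clique_density s R" using weighted_clique_density_nonneg[OF R(1), of s] by simp
    then have "(1 - \<kappa>) * weighted_clique_density s R < (1 - 2 * \<eta> * (real s)\<^sup>2) * weighted_clique_density s R"
      using \<eta>(3) by (intro mult_strict_right_mono) auto
    moreover have "(\<lambda>N. (1 - 2 * \<eta> * (real s)\<^sup>2) * D N) \<longlonglongrightarrow> (1 - 2 * \<eta> * (real s)\<^sup>2) * weighted_clique_density s R"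
      by (rule tendsto_mult[OF tendsto_const D])
    ultimately have "\<forall>\<^sub>F N in sequentially. (1 - \<kappa>) * weighted_clique_density s R < (1 - 2 * \<eta> * (real s)\<^sup>2) * D N"
      by (rule order_tendstoD(1)[rotated])
    then show ?thesis by eventually_elim simp
  qed simp
  \<comment> \<open>From here on the constant error in the independence bound is at most
    \<open>\<theta> * N\<close>.\<close>
  have big: "\<forall>\<^sub>F N in sequentially. real (card X) * real (card ?V) * ?C \<le> real N"
    by (rule filterlim_at_top[THEN iffD1, rule_format, OF filterlim_real_sequentially])
  show ?thesis
    using dens big
  proof eventually_elim
    case (elim N)
    interpret B: blowup R X H \<M> F \<theta> \<eta> idx N "\<tau> N" by (rule blow)
    have w: "B.tuple_weight s = w" by (simp add: fun_eq_iff B.tuple_weight_def B.pairs_def w_def)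
    obtain \<phi> where \<phi>: "\<phi> \<in> B.choices" "(1 - 2 * \<eta> * (real s)\<^sup>2) * D N \<le> clique_density s (B.G \<phi>)"
      using B.ex_choice_density[of s] \<eta>(1,2) unfolding w D_def n_def by auto
    have "real (independence_number (B.G \<phi>)) \<le> \<theta> * real N + \<theta> * real (card X) * real (card ?V) * ?C"
    proof (rule B.independence_number_G_le)
      fix v x assume "v \<in> ?V" "x \<in> X"
      then show "real (card {i \<in> {..<N}. \<tau> N i = (v, x)}) \<le> vweight R v * real N / real (card X) + ?C"
        using \<tau>(2)[of "(v, x)" N] by (simp add: p_def)
    qed simp
    also have "\<dots> = \<theta> * real N + \<theta> * (real (card X) * real (card ?V) * ?C)" by (simp only: mult.assoc)
    also have "\<dots> \<le> \<theta> * real N + \<theta> * real N" using elim(2) \<theta> by (intro add_left_mono mult_left_mono) auto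
    finally have "real (independence_number (B.G \<phi>)) \<le> 2 * \<theta> * real N" by simp
    moreover have "clique_free t (B.G \<phi>)"
      by (rule B.clique_free_G[OF R(2) t]) (use \<phi>(1) in \<open>auto simp: B.choices_def PiE_iff\<close>)
    moreover have "0 \<le> clique_density s (B.G \<phi>)" by (simp add: clique_density_def)
    then have "(1 - \<kappa>) * weighted_clique_density s R \<le> clique_density s (B.G \<phi>)"
      using elim(1) \<phi>(2) by auto
    ultimately show ?case
      using B.finite_simple_graph_G by (intro exI[of _ "B.G \<phi>"]) simp
  qed
qed

theorem theorem2p11:
  fixes R :: "'a wgraph" and t s h :: nat and \<epsilon> :: real
  assumes "t \<ge> 3" and "s \<ge> 1"
    and "weighted_graph R" and "weighted_clique_free t R"
    and "\<epsilon> > 0" and "h \<ge> 16"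
  shows "\<forall>\<^sub>F N in sequentially. \<exists>G :: nat graph.
           finite_simple_graph G \<and> card (verts G) = N \<and> clique_free t G \<and>
           real (independence_number G) \<le> 3 * exp (- \<epsilon> * sqrt (real h) / 4) * real N \<and>
           clique_density s G \<ge>
             (1 - 2 * sqrt 2 * (real s)\<^sup>2 * \<epsilon>) * weighted_clique_density s R"
proof -
  let ?\<theta> = "exp (- \<epsilon> * sqrt (real h) / 4)"
  \<comment> \<open>The loss allowed by the claim serves as \<open>\<kappa>\<close> and
    \<open>?\<theta>\<close> as the constant \<open>\<theta>\<close>; the resulting bound
    \<open>2 * ?\<theta> * N\<close> fits below the claimed one with factor 3.\<close>
  have "0 < 2 * sqrt 2 * (real s)\<^sup>2 * \<epsilon>" using assms by simp
  from ramsey_turan_blowup[OF assms(3,4,1) exp_gt_zero this, of "- \<epsilon> * sqrt (real h) / 4" s]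
  show ?thesis
  proof eventually_elim
    case (elim N)
    have "2 * ?\<theta> * real N \<le> 3 * ?\<theta> * real N" by (intro mult_right_mono) auto
    then show ?case using elim order_trans by blast
  qed
qed

end
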